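(* Let the immersion $X\in C^3(B,\mathbb R^3)$, with $C^2$-regular boundary curve, represent a geodesic disc $\mathfrak B_r(X_0)$ of radius $r>0$ and center $X_0$, and let its Gaussian curvature satisfy $K\le K_0$ on the whole surface with a real constant $K_0\in[0,+\infty)$. Let $\kappa\ge 0$ denote the curvature of the boundary curve. Then $$\mathcal A[X]\le\frac{K_0}{2}\,\mathcal A[X]\,r^2+\frac{r^2}{2}\int_{\partial B}\kappa(s)\,ds .$$ In particular, if $K_0=0$, then $$\mathcal A[X]\le\frac{r^2}{2}\int_{\partial B}\kappa(s)\,ds .$$
   Context: $B=\{(u,v)\in\mathbb R^2: u^2+v^2\le 1\}$. An immersion $X\in C^3(B,\mathbb R^3)$ has $\mathrm{rank}\,\partial X=2$ in $B$. Its area is $\mathcal A[X]=\iint_B|X_u\times X_v|\,du\,dv$, and $K$ is its Gaussian curvature. The curvature of the boundary curve $X|_{\partial B}$ as a space curve is $\kappa=\sqrt{\kappa_g^2+\kappa_n^2}$, where $\kappa_g$ and $\kappa_n$ are its geodesic and normal curvature. $\int_{\partial B}\kappa(s)\,ds$ is the integral of $\kappa$ along the boundary curve with respect to its arc length $s$. Geodesic disc: $X$ represents a geodesic disc $\mathfrak B_r(X_0)$ of radius $r$ and center $X_0$ if the whole surface, with the metric induced from $\mathbb R^3$, is described by geodesic polar coordinates $(\varrho,\varphi)\in[0,r]\times[0,2\pi]$ around $X_0$. In these coordinates the metric is $d\varrho^2+P(\varrho,\varphi)\,d\varphi^2$ with $P>0$ on $(0,r]\times[0,2\pi)$, $\lim_{\varrho\to0_+}P(\varrho,\varphi)=0$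 and $\lim_{\varrho\to0_+}\frac{\partial}{\partial\varrho}\sqrt{P(\varrho,\varphi)}=1$. The boundary of the surface is the curve $\varrho=r$. *)

theory Defs
  imports "HOL-Analysis.Analysis"
begin

section \<open>Differentiability classes\<close>

text \<open>Directional derivative of \<open>f\<close> at \<open>x\<close> in direction \<open>e\<close>, taken within \<open>S\<close>. It is used only for
  convex sets \<open>S\<close> with non-empty interior, where the derivative within \<open>S\<close> is unique
  also at the boundary points belonging to \<open>S\<close>.\<close>

definition dderiv ::
  "'a::real_normed_vector set \<Rightarrow> 'a \<Rightarrow> ('a \<Rightarrow> 'b::real_normed_vector) \<Rightarrow> 'a \<Rightarrow> 'b" where
  "dderiv S e f x = frechet_derivative f (at x within S) e"

text \<open>For \<open>S\<close> as above this is the usual class \<open>C\<^sup>k\<close>: on a closed disc, \<open>C\<^sup>k\<close> in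
  the interior with all derivatives up to order \<open>k\<close> extending continuously to the boundary.\<close>

primrec C_k_on ::
  "nat \<Rightarrow> ('a::real_normed_vector \<Rightarrow> 'b::real_normed_vector) \<Rightarrow> 'a set \<Rightarrow> bool" where
  "C_k_on 0 f S \<longleftrightarrow> continuous_on S f"
| "C_k_on (Suc k) f S \<longleftrightarrow> f differentiable_on S \<and> (\<forall>e. C_k_on k (dderiv S e f) S)"

section \<open>Immersed discs in three-space\<close>

definition disc :: "(real \<times> real) set" where
  "disc = {(u, v). u\<^sup>2 + v\<^sup>2 \<le> 1}"

definition circle :: "(real \<times> real) set" where
  "circle = {(u, v). u\<^sup>2 + v\<^sup>2 = 1}"

definition immersion_disc :: "(real \<times> real \<Rightarrow> real ^ 3) \<Rightarrow> bool" where
  "immersion_disc X \<longleftrightarrow> (\<forall>w\<in>disc. dim (range (frechet_derivative X (at w within disc))) = 2)"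

definition D_u :: "(real \<times> real \<Rightarrow> real ^ 3) \<Rightarrow> real \<times> real \<Rightarrow> real ^ 3" where
  "D_u = dderiv disc (1, 0)"

definition D_v :: "(real \<times> real \<Rightarrow> real ^ 3) \<Rightarrow> real \<times> real \<Rightarrow> real ^ 3" where
  "D_v = dderiv disc (0, 1)"

definition surface_area :: "(real \<times> real \<Rightarrow> real ^ 3) \<Rightarrow> real" where
  "surface_area X = integral disc (\<lambda>w. norm (cross3 (D_u X w) (D_v X w)))"

definition unit_normal :: "(real \<times> real \<Rightarrow> real ^ 3) \<Rightarrow> real \<times> real \<Rightarrow> real ^ 3" where
  "unit_normal X w =
     cross3 (D_u X w) (D_v X w) /\<^sub>R norm (cross3 (D_u X w) (D_v X w))"

definition gauss_curvature :: "(real \<times> real \<Rightarrow> real ^ 3) \<Rightarrow> real \<times> real \<Rightarrow> real" where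
  "gauss_curvature X w =
     (let N = unit_normal X w;
          E = D_u X w \<bullet> D_u X w; F = D_u X w \<bullet> D_v X w; G = D_v X w \<bullet> D_v X w;
          L = D_u (D_u X) w \<bullet> N; M = D_v (D_u X) w \<bullet> N; Q = D_v (D_v X) w \<bullet> N
      in (L * Q - M\<^sup>2) / (E * G - F\<^sup>2))"

section \<open>The boundary curve\<close>

definition boundary_curve :: "(real \<times> real \<Rightarrow> real ^ 3) \<Rightarrow> real \<Rightarrow> real ^ 3" where
  "boundary_curve X t = X (cos t, sin t)"

definition C2_regular_curve :: "(real \<Rightarrow> real ^ 3) \<Rightarrow> bool" where
  "C2_regular_curve c \<longleftrightarrow> C_k_on 2 c UNIV \<and> (\<forall>t. vector_derivative c (at t) \<noteq> 0)"

definition boundary_velocity :: "(real \<times> real \<Rightarrow> real ^ 3) \<Rightarrow> real \<Rightarrow> real ^ 3" where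
  "boundary_velocity X t = vector_derivative (boundary_curve X) (at t)"

definition boundary_accel :: "(real \<times> real \<Rightarrow> real ^ 3) \<Rightarrow> real \<Rightarrow> real ^ 3" where
  "boundary_accel X t = vector_derivative (boundary_velocity X) (at t)"

text \<open>The parameter \<open>t\<close> is not arc length, whence the powers of the speed in the denominators.\<close>

definition normal_curvature :: "(real \<times> real \<Rightarrow> real ^ 3) \<Rightarrow> real \<Rightarrow> real" where
  "normal_curvature X t =
     boundary_accel X t \<bullet> unit_normal X (cos t, sin t) / norm (boundary_velocity X t) ^ 2"

definition geodesic_curvature :: "(real \<times> real \<Rightarrow> real ^ 3) \<Rightarrow> real \<Rightarrow> real" where
  "geodesic_curvature X t =
     boundary_accel X t \<bullet> cross3 (unit_normal X (cos t, sin t)) (boundary_velocity X t)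
       / norm (boundary_velocity X t) ^ 3"

definition boundary_curvature :: "(real \<times> real \<Rightarrow> real ^ 3) \<Rightarrow> real \<Rightarrow> real" where
  "boundary_curvature X t = sqrt ((geodesic_curvature X t)\<^sup>2 + (normal_curvature X t)\<^sup>2)"

definition total_boundary_curvature :: "(real \<times> real \<Rightarrow> real ^ 3) \<Rightarrow> real" where
  "total_boundary_curvature X =
     integral {0..2 * pi} (\<lambda>t. boundary_curvature X t * norm (boundary_velocity X t))"

section \<open>Geodesic discs\<close>

definition polar_rect :: "real \<Rightarrow> (real \<times> real) set" where
  "polar_rect r = {(\<rho>, \<phi>). 0 < \<rho> \<and> \<rho> \<le> r \<and> 0 \<le> \<phi> \<and> \<phi> \<le> 2 * pi}"

text \<open>\<open>\<Phi>\<close> sends the geodesic polar coordinates \<open>(\<rho>, \<phi>)\<close> to the parameter disc, \<open>\<rho> = 0\<close> being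
  collapsed to the preimage \<open>w\<^sub>0\<close> of the centre. The smoothness demanded of \<open>\<Phi>\<close>,
  namely that \<open>\<Phi>\<close> and its radial derivative are \<open>C\<^sup>1\<close>, is the one that the exponential map of a
  \<open>C\<^sup>2\<close> metric always has; the induced metric of a \<open>C\<^sup>3\<close> immersion is only \<open>C\<^sup>2\<close>.\<close>

definition geodesic_polar_coordinates ::
  "(real \<times> real \<Rightarrow> real ^ 3) \<Rightarrow> real \<times> real \<Rightarrow> real \<Rightarrow>
   (real \<times> real \<Rightarrow> real \<times> real) \<Rightarrow> (real \<times> real \<Rightarrow> real) \<Rightarrow> bool" where
  "geodesic_polar_coordinates X w\<^sub>0 r \<Phi> P \<longleftrightarrow>
     (let S = polar_rect r;
          Y_\<rho> = dderiv S (1, 0) (X \<circ> \<Phi>);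
          Y_\<phi> = dderiv S (0, 1) (X \<circ> \<Phi>)
      in
        continuous_on {(\<rho>, \<phi>). 0 \<le> \<rho> \<and> \<rho> \<le> r \<and> 0 \<le> \<phi> \<and> \<phi> \<le> 2 * pi} \<Phi> \<and>
        C_k_on 1 \<Phi> S \<and> C_k_on 1 (dderiv S (1, 0) \<Phi>) S \<and>
        (\<forall>\<phi>\<in>{0..2 * pi}. \<Phi> (0, \<phi>) = w\<^sub>0) \<and>
        (\<forall>\<rho>\<in>{0..r}. \<Phi> (\<rho>, 0) = \<Phi> (\<rho>, 2 * pi)) \<and>
        bij_betw \<Phi> {(\<rho>, \<phi>). 0 < \<rho> \<and> \<rho> \<le> r \<and> 0 \<le> \<phi> \<and> \<phi> < 2 * pi} (disc - {w\<^sub>0}) \<and>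
        (\<lambda>\<phi>. \<Phi> (r, \<phi>)) ` {0..2 * pi} = circle \<and>
        (\<forall>(\<rho>, \<phi>)\<in>S.
           Y_\<rho> (\<rho>, \<phi>) \<bullet> Y_\<rho> (\<rho>, \<phi>) = 1 \<and>
           Y_\<rho> (\<rho>, \<phi>) \<bullet> Y_\<phi> (\<rho>, \<phi>) = 0 \<and>
           Y_\<phi> (\<rho>, \<phi>) \<bullet> Y_\<phi> (\<rho>, \<phi>) = P (\<rho>, \<phi>)) \<and>
        (\<forall>\<rho>\<in>{0<..r}. \<forall>\<phi>\<in>{0..<2 * pi}. P (\<rho>, \<phi>) > 0) \<and>
        (\<forall>\<phi>\<in>{0..2 * pi}.
           ((\<lambda>\<rho>. P (\<rho>, \<phi>)) \<longlongrightarrow> 0) (at_right 0) \<and>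
           ((\<lambda>\<rho>. deriv (\<lambda>s. sqrt (P (s, \<phi>))) \<rho>) \<longlongrightarrow> 1) (at_right 0)))"

definition geodesic_disc :: "(real \<times> real \<Rightarrow> real ^ 3) \<Rightarrow> real ^ 3 \<Rightarrow> real \<Rightarrow> bool" where
  "geodesic_disc X X\<^sub>0 r \<longleftrightarrow>
     (\<exists>w\<^sub>0\<in>disc. X w\<^sub>0 = X\<^sub>0 \<and> (\<exists>\<Phi> P. geodesic_polar_coordinates X w\<^sub>0 r \<Phi> P))"

end

theory Submission
  imports Defs
begin

text \<open>
  In geodesic polar coordinates the area element of the surface is \<open>J d\<rho> d\<phi>\<close>, where
  \<open>J = \<surd>P\<close> vanishes at the centre and satisfies the Jacobi equation \<open>J\<^sub>\<rho>\<^sub>\<rho> = - K J\<close>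
  along every radius. Since \<open>K \<le> K\<^sub>0\<close>, integrating from \<open>\<rho>\<close> to \<open>r\<close> gives
  \<open>J\<^sub>\<rho>(\<rho>) \<le> J\<^sub>\<rho>(r) + K\<^sub>0 F\<close> with \<open>F = \<integral>\<^sub>0\<^sup>r J\<close>, hence \<open>J(\<rho>) \<le> \<rho> (J\<^sub>\<rho>(r) + K\<^sub>0 F)\<close>. A second
  integration yields \<open>F \<le> r\<^sup>2/2 (J\<^sub>\<rho>(r) + K\<^sub>0 F)\<close>, and \<open>J\<^sub>\<rho>(r) d\<phi>\<close> is \<open>\<kappa>\<^sub>g ds\<close> on the
  boundary up to sign, which is at most \<open>\<kappa> ds\<close>. Integrating over the angle gives the theorem. If
  \<open>K\<^sub>0 r\<^sup>2/2 \<ge> 1\<close> the inequality is trivial; otherwise the pointwise estimate becomes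
  \<open>J(\<rho>) (1 - K\<^sub>0 r\<^sup>2/2) \<le> \<rho> J\<^sub>\<rho>(r)\<close> (\<open>concavity_defect_bound\<close>). Its right-hand side is continuous
  up to \<open>\<rho> = 0\<close>, where nothing is assumed about \<open>J\<close> uniformly in the angle, so that it
  also provides the integrable majorant for the area.

  The delicate point is the Jacobi equation, because the map \<open>\<Phi>\<close> from polar coordinates to the
  disc is only \<open>C\<^sup>1\<close> together with its radial derivative. Let \<open>Z\<close> and \<open>V\<close> be the radial and the
  angular derivative of \<open>X \<circ> \<Phi>\<close> and \<open>n\<close> the normal. The Gauss lemma hypotheses \<open>|Z| = 1\<close> and
  \<open>Z \<bullet> V = 0\<close> force \<open>Z\<^sub>\<rho> = l n\<close>: radii are geodesics. The coefficient \<open>l\<close> is the second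
  fundamental form on \<open>Z\<close>, which involves only second derivatives of \<open>X\<close> and the radial
  derivative of \<open>\<Phi>\<close>, so \<open>l n\<close> is again \<open>C\<^sup>1\<close>. This gain of one derivative allows the mixed
  derivatives of \<open>Z\<close> to be interchanged (\<open>mixed_partials\<close>) and makes \<open>J\<close> twice differentiable
  in \<open>\<rho>\<close>. Up to sign \<open>J = V \<bullet> (n \<times> Z)\<close>, and the equation is then vector algebra
  together with \<open>n\<^sub>u \<times> n\<^sub>v = K X\<^sub>u \<times> X\<^sub>v\<close> (\<open>jacobi_equation\<close>, \<open>weingarten_gauss\<close>).

  On the boundary, \<open>\<Phi>(r, \<phi>) = (cos \<theta>, sin \<theta>)\<close> for a differentiable angle \<open>\<theta>\<close>, and
  \<open>J1_boundary\<close> identifies \<open>|J\<^sub>\<rho>|\<close> with \<open>|\<kappa>\<^sub>g|\<close> times the speed of \<open>\<phi> \<mapsto> X(cos \<theta>, sin \<theta>)\<close>. The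
  area and the boundary integral are compared with their expressions in polar coordinates by inequalities
  (\<open>integral_image_le_plane\<close> and \<open>integral_substitution_injective_circle\<close>).
\<close>

section \<open>Continuously differentiable functions of two variables\<close>

text \<open>On the boundary of a set the derivative within it need not be unique. Carrying the partial
  derivatives as explicit arguments avoids every appeal to uniqueness in the rules below, and a
  function of class \<open>C_k_on 1\<close> supplies them through \<open>dderiv\<close>.\<close>

definition C1_partials ::
  "(real \<times> real \<Rightarrow> 'b::real_normed_vector) \<Rightarrow> (real \<times> real \<Rightarrow> 'b) \<Rightarrow> (real \<times> real \<Rightarrow> 'b) \<Rightarrow>
   (real \<times> real) set \<Rightarrow> bool" where
  "C1_partials f f\<^sub>1 f\<^sub>2 S \<longleftrightarrow>
     (\<forall>x\<in>S. (f has_derivative (\<lambda>h. fst h *\<^sub>R f\<^sub>1 x + snd h *\<^sub>R f\<^sub>2 x)) (at x within S)) \<and>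
     continuous_on S f\<^sub>1 \<and> continuous_on S f\<^sub>2"

lemma C1_partialsD:
  assumes "C1_partials f f\<^sub>1 f\<^sub>2 S"
  shows "x \<in> S \<Longrightarrow> (f has_derivative (\<lambda>h. fst h *\<^sub>R f\<^sub>1 x + snd h *\<^sub>R f\<^sub>2 x)) (at x within S)"
    and "continuous_on S f\<^sub>1" and "continuous_on S f\<^sub>2" and "continuous_on S f"
  using assms unfolding C1_partials_def
  by (auto simp: continuous_on_eq_continuous_within intro: has_derivative_continuous)

lemma C1_partials_subset: "C1_partials f f\<^sub>1 f\<^sub>2 S \<Longrightarrow> T \<subseteq> S \<Longrightarrow> C1_partials f f\<^sub>1 f\<^sub>2 T"
  unfolding C1_partials_def by (meson continuous_on_subset has_derivative_subset subsetD)

lemma C_k_on_1_imp_C1_partials: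
  assumes "C_k_on 1 f S"
  shows "C1_partials f (dderiv S (1, 0) f) (dderiv S (0, 1) f) S"
proof -
  have d: "f differentiable_on S" and c: "\<And>e. continuous_on S (dderiv S e f)"
    using assms by (auto simp: One_nat_def simp del: One_nat_def[symmetric])
  have "(f has_derivative (\<lambda>h. fst h *\<^sub>R dderiv S (1, 0) f x + snd h *\<^sub>R dderiv S (0, 1) f x)) (at x within S)"
    if "x \<in> S" for x
  proof -
    have D: "(f has_derivative frechet_derivative f (at x within S)) (at x within S)"
      using d that by (auto simp: differentiable_on_def frechet_derivative_works)
    then interpret bounded_linear "frechet_derivative f (at x within S)"
      by (rule has_derivative_bounded_linear)
    have "frechet_derivative f (at x within S) =
          (\<lambda>h. fst h *\<^sub>R dderiv S (1, 0) f x + snd h *\<^sub>R dderiv S (0, 1) f x)"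
    proof
      fix h :: "real \<times> real"
      have "h = fst h *\<^sub>R (1, 0) + snd h *\<^sub>R (0, 1)"
        by (cases h) auto
      then show "frechet_derivative f (at x within S) h =
          fst h *\<^sub>R dderiv S (1, 0) f x + snd h *\<^sub>R dderiv S (0, 1) f x"
        unfolding dderiv_def by (metis add scaleR)
    qed
    then show ?thesis using D by simp
  qed
  then show ?thesis unfolding C1_partials_def using c by auto
qed

lemma C_k_on_Suc_imp: "C_k_on (Suc k) f S \<Longrightarrow> C_k_on k f S"
proof (induction k arbitrary: f)
  case 0
  then show ?case by (auto intro: differentiable_imp_continuous_on)
next
  case (Suc k)
  then show ?case by (metis C_k_on.simps(2))
qed

lemma C1_partials_bilinear:
  assumes b: "bounded_bilinear b"
    and f: "C1_partials f f\<^sub>1 f\<^sub>2 S" and g: "C1_partials g g\<^sub>1 g\<^sub>2 S"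
  shows "C1_partials (\<lambda>x. b (f x) (g x)) (\<lambda>x. b (f x) (g\<^sub>1 x) + b (f\<^sub>1 x) (g x))
           (\<lambda>x. b (f x) (g\<^sub>2 x) + b (f\<^sub>2 x) (g x)) S"
proof -
  interpret bounded_bilinear b by (rule b)
  have "((\<lambda>x. b (f x) (g x)) has_derivative
      (\<lambda>h. fst h *\<^sub>R (b (f x) (g\<^sub>1 x) + b (f\<^sub>1 x) (g x)) + snd h *\<^sub>R (b (f x) (g\<^sub>2 x) + b (f\<^sub>2 x) (g x))))
      (at x within S)" if "x \<in> S" for x
    by (rule has_derivative_eq_rhs[OF FDERIV[OF C1_partialsD(1)[OF f that] C1_partialsD(1)[OF g that]]])
       (auto simp: fun_eq_iff add_left add_right scaleR_left scaleR_right algebra_simps)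
  then show ?thesis
    unfolding C1_partials_def using C1_partialsD(2-)[OF f] C1_partialsD(2-)[OF g]
    by (auto intro!: continuous_on_add continuous_on)
qed

lemma C1_partials_add:
  assumes f: "C1_partials f f\<^sub>1 f\<^sub>2 S" and g: "C1_partials g g\<^sub>1 g\<^sub>2 S"
  shows "C1_partials (\<lambda>x. f x + g x) (\<lambda>x. f\<^sub>1 x + g\<^sub>1 x) (\<lambda>x. f\<^sub>2 x + g\<^sub>2 x) S"
proof -
  have "((\<lambda>x. f x + g x) has_derivative
      (\<lambda>h. fst h *\<^sub>R (f\<^sub>1 x + g\<^sub>1 x) + snd h *\<^sub>R (f\<^sub>2 x + g\<^sub>2 x))) (at x within S)" if "x \<in> S" for x
    by (rule has_derivative_eq_rhs[OF has_derivative_add[OF C1_partialsD(1)[OF f that] C1_partialsD(1)[OF g that]]])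
       (auto simp: fun_eq_iff algebra_simps)
  then show ?thesis
    unfolding C1_partials_def using C1_partialsD(2-)[OF f] C1_partialsD(2-)[OF g]
    by (auto intro!: continuous_on_add)
qed

lemma C1_partials_linear:
  assumes l: "bounded_linear l" and f: "C1_partials f f\<^sub>1 f\<^sub>2 S"
  shows "C1_partials (\<lambda>x. l (f x)) (\<lambda>x. l (f\<^sub>1 x)) (\<lambda>x. l (f\<^sub>2 x)) S"
proof -
  interpret bounded_linear l by (rule l)
  have "((\<lambda>x. l (f x)) has_derivative
      (\<lambda>h. fst h *\<^sub>R l (f\<^sub>1 x) + snd h *\<^sub>R l (f\<^sub>2 x))) (at x within S)" if "x \<in> S" for x
    by (rule has_derivative_eq_rhs[OF has_derivative[OF C1_partialsD(1)[OF f that]]])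
       (auto simp: fun_eq_iff add scaleR)
  then show ?thesis
    unfolding C1_partials_def using C1_partialsD(2-)[OF f]
    by (auto intro!: continuous_on)
qed

lemma C1_partials_compose:
  assumes f: "C1_partials f f\<^sub>1 f\<^sub>2 T" and g: "C1_partials g g\<^sub>1 g\<^sub>2 S" and sub: "g ` S \<subseteq> T"
  shows "C1_partials (\<lambda>x. f (g x))
           (\<lambda>x. fst (g\<^sub>1 x) *\<^sub>R f\<^sub>1 (g x) + snd (g\<^sub>1 x) *\<^sub>R f\<^sub>2 (g x))
           (\<lambda>x. fst (g\<^sub>2 x) *\<^sub>R f\<^sub>1 (g x) + snd (g\<^sub>2 x) *\<^sub>R f\<^sub>2 (g x)) S"
proof -
  have "((\<lambda>x. f (g x)) has_derivative
      (\<lambda>h. fst h *\<^sub>R (fst (g\<^sub>1 x) *\<^sub>R f\<^sub>1 (g x) + snd (g\<^sub>1 x) *\<^sub>R f\<^sub>2 (g x)) +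
           snd h *\<^sub>R (fst (g\<^sub>2 x) *\<^sub>R f\<^sub>1 (g x) + snd (g\<^sub>2 x) *\<^sub>R f\<^sub>2 (g x)))) (at x within S)"
    if "x \<in> S" for x
    by (rule has_derivative_eq_rhs[OF has_derivative_in_compose2[OF C1_partialsD(1)[OF f] sub that
              C1_partialsD(1)[OF g that]]])
       (auto simp: fun_eq_iff algebra_simps)
  moreover have "continuous_on S (\<lambda>x. f\<^sub>1 (g x))" "continuous_on S (\<lambda>x. f\<^sub>2 (g x))"
    using C1_partialsD(2-)[OF f] C1_partialsD(4)[OF g] sub
    by (auto intro: continuous_on_compose2)
  ultimately show ?thesis
    unfolding C1_partials_def using C1_partialsD(2-)[OF g]
    by (auto intro!: continuous_intros)
qed

lemma C1_partials_real_compose: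
  assumes h: "\<And>y. y \<in> T \<Longrightarrow> (h has_real_derivative h' y) (at y)" and ch: "continuous_on T h'"
    and f: "C1_partials f f\<^sub>1 f\<^sub>2 S" and sub: "f ` S \<subseteq> T"
  shows "C1_partials (\<lambda>x. h (f x)) (\<lambda>x. h' (f x) * f\<^sub>1 x) (\<lambda>x. h' (f x) * f\<^sub>2 x) S"
proof -
  have "((\<lambda>x. h (f x)) has_derivative
      (\<lambda>k. fst k *\<^sub>R (h' (f x) * f\<^sub>1 x) + snd k *\<^sub>R (h' (f x) * f\<^sub>2 x))) (at x within S)" if "x \<in> S" for x
  proof -
    have "(h has_derivative (\<lambda>k. h' (f x) * k)) (at (f x))"
      using h[of "f x"] sub that by (auto simp: has_field_derivative_def)
    from has_derivative_compose[OF C1_partialsD(1)[OF f that] this]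
    show ?thesis by (rule has_derivative_eq_rhs) (auto simp: fun_eq_iff algebra_simps)
  qed
  moreover have "continuous_on S (\<lambda>x. h' (f x))"
    using ch C1_partialsD(4)[OF f] sub by (auto intro: continuous_on_compose2)
  ultimately show ?thesis
    unfolding C1_partials_def using C1_partialsD(2-)[OF f]
    by (auto intro!: continuous_intros)
qed

lemma C1_partials_D1:
  assumes f: "C1_partials f f\<^sub>1 f\<^sub>2 S" and sub: "(\<lambda>s. (s, y)) ` A \<subseteq> S" and x: "x \<in> A"
  shows "((\<lambda>s. f (s, y)) has_vector_derivative f\<^sub>1 (x, y)) (at x within A)"
proof -
  have "((\<lambda>s. (s, y)) has_derivative (\<lambda>h. (h, 0))) (at x within A)"
    by (auto intro!: derivative_eq_intros)
  from has_derivative_in_compose2[OF C1_partialsD(1)[OF f] sub x this]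
  show ?thesis unfolding has_vector_derivative_def by simp
qed

lemma C1_partials_D2:
  assumes f: "C1_partials f f\<^sub>1 f\<^sub>2 S" and sub: "(\<lambda>s. (x, s)) ` A \<subseteq> S" and y: "y \<in> A"
  shows "((\<lambda>s. f (x, s)) has_vector_derivative f\<^sub>2 (x, y)) (at y within A)"
proof -
  have "((\<lambda>s. (x, s)) has_derivative (\<lambda>h. (0, h))) (at y within A)"
    by (auto intro!: derivative_eq_intros)
  from has_derivative_in_compose2[OF C1_partialsD(1)[OF f] sub y this]
  show ?thesis unfolding has_vector_derivative_def by simp
qed

text \<open>If \<open>f\<^sub>1\<^sub>2\<close> is continuous, then \<open>f\<^sub>2\<^sub>1\<close> exists and equals it; its existence is part of the conclusion.
  Differentiating \<open>f(x, y) = f(a, y) + \<integral>\<^sub>a\<^sup>x f\<^sub>1(s, y) ds\<close> under the integral sign gives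
  \<open>f\<^sub>2(x, y) = f\<^sub>2(a, y) + \<integral>\<^sub>a\<^sup>x f\<^sub>1\<^sub>2(s, y) ds\<close>, whose derivative in \<open>x\<close> is evident.\<close>

lemma mixed_partials:
  fixes f :: "real \<times> real \<Rightarrow> 'b::banach"
  assumes f1: "\<And>x y. x \<in> {a..b} \<Longrightarrow> y \<in> U \<Longrightarrow> ((\<lambda>s. f (s, y)) has_vector_derivative f\<^sub>1 (x, y)) (at x within {a..b})"
    and f2: "\<And>x y. x \<in> {a..b} \<Longrightarrow> y \<in> U \<Longrightarrow> ((\<lambda>s. f (x, s)) has_vector_derivative f\<^sub>2 (x, y)) (at y within U)"
    and f12: "\<And>x y. x \<in> {a..b} \<Longrightarrow> y \<in> U \<Longrightarrow> ((\<lambda>s. f\<^sub>1 (x, s)) has_vector_derivative f\<^sub>1\<^sub>2 (x, y)) (at y within U)"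
    and c1: "continuous_on ({a..b} \<times> U) f\<^sub>1" and c12: "continuous_on ({a..b} \<times> U) f\<^sub>1\<^sub>2"
    and U: "convex U" and y: "y \<in> U" "at y within U \<noteq> bot" and x: "x \<in> {a..b}"
  shows "((\<lambda>s. f\<^sub>2 (s, y)) has_vector_derivative f\<^sub>1\<^sub>2 (x, y)) (at x within {a..b})"
proof -
  have c1': "continuous_on {a..b} (\<lambda>s. f\<^sub>1 (s, z))" if "z \<in> U" for z
    using that by (auto intro!: continuous_on_compose2[OF c1] continuous_intros)
  have c12': "continuous_on {a..b} (\<lambda>s. f\<^sub>1\<^sub>2 (s, z))" if "z \<in> U" for z
    using that by (auto intro!: continuous_on_compose2[OF c12] continuous_intros)
  have ftc: "f (s, z) = f (a, z) + integral {a..s} (\<lambda>t. f\<^sub>1 (t, z))" if "s \<in> {a..b}" "z \<in> U" for s z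
  proof -
    have "((\<lambda>t. f\<^sub>1 (t, z)) has_integral f (s, z) - f (a, z)) {a..s}"
      using that
      by (intro fundamental_theorem_of_calculus) (auto intro: has_vector_derivative_within_subset[OF f1])
    then show ?thesis by (simp add: integral_unique)
  qed
  have f2_eq: "f\<^sub>2 (s, y) = f\<^sub>2 (a, y) + integral {a..s} (\<lambda>t. f\<^sub>1\<^sub>2 (t, y))" if s: "s \<in> {a..b}" for s
  proof -
    have "((\<lambda>z. integral (cbox a s) (\<lambda>t. f\<^sub>1 (t, z))) has_vector_derivative
            integral (cbox a s) (\<lambda>t. f\<^sub>1\<^sub>2 (t, y))) (at y within U)"
    proof (rule leibniz_rule_vector_derivative)
      show "continuous_on (U \<times> cbox a s) (\<lambda>(z, t). f\<^sub>1\<^sub>2 (t, z))"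
        using s unfolding split_beta
        by (auto intro!: continuous_on_compose2[OF c12] continuous_intros)
      show "(\<lambda>t. f\<^sub>1 (t, z)) integrable_on cbox a s" if "z \<in> U" for z
        using s by (auto intro!: integrable_continuous_real continuous_on_subset[OF c1'[OF that]])
    qed (use s f12 U y in auto)
    moreover have "((\<lambda>z. f (a, z)) has_vector_derivative f\<^sub>2 (a, y)) (at y within U)"
      using f2[of a y] s y by auto
    ultimately have "((\<lambda>z. f (a, z) + integral {a..s} (\<lambda>t. f\<^sub>1 (t, z))) has_vector_derivative
        f\<^sub>2 (a, y) + integral {a..s} (\<lambda>t. f\<^sub>1\<^sub>2 (t, y))) (at y within U)"
      by (intro has_vector_derivative_add) auto
    then have "((\<lambda>z. f (s, z)) has_vector_derivative
        f\<^sub>2 (a, y) + integral {a..s} (\<lambda>t. f\<^sub>1\<^sub>2 (t, y))) (at y within U)"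
      by (rule has_vector_derivative_transform[OF y(1), rotated]) (rule ftc[OF s])
    then show ?thesis
      using vector_derivative_unique_within[OF y(2)] f2[OF s y(1)] by blast
  qed
  have "((\<lambda>s. f\<^sub>2 (a, y) + integral {a..s} (\<lambda>t. f\<^sub>1\<^sub>2 (t, y))) has_vector_derivative f\<^sub>1\<^sub>2 (x, y)) (at x within {a..b})"
    using has_vector_derivative_add[OF has_vector_derivative_const
        integral_has_vector_derivative[OF c12'[OF y(1)] x]] by simp
  then show ?thesis
    by (rule has_vector_derivative_transform[OF x, rotated]) (rule f2_eq)
qed

section \<open>Comparison along a radius\<close>

text \<open>The two integrations of the Jacobi inequality. With \<open>F(y) = \<integral>\<^sub>0\<^sup>y j\<close> the function \<open>j' + K F\<close> is
  increasing, so \<open>j' \<le> m\<close> for \<open>m = j'(r) + K F(r)\<close>. Hence \<open>j(y) \<le> m y\<close> and \<open>F(r) \<le> m r\<^sup>2/2\<close>, and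
  inserting the latter into \<open>m\<close> gives \<open>m (1 - K r\<^sup>2/2) \<le> j'(r)\<close>.\<close>

lemma concavity_defect_bound:
  fixes j j' j'' :: "real \<Rightarrow> real"
  assumes r: "r > 0" and K: "K \<ge> 0" and small: "K / 2 * r\<^sup>2 < 1"
    and pos: "\<And>x. x \<in> {0<..r} \<Longrightarrow> j x \<ge> 0"
    and lim: "(j \<longlongrightarrow> 0) (at_right 0)"
    and cj: "continuous_on {0<..r} j" and cj': "continuous_on {0<..r} j'"
    and d1: "\<And>x. x \<in> {0<..<r} \<Longrightarrow> (j has_real_derivative j' x) (at x)"
    and d2: "\<And>x. x \<in> {0<..<r} \<Longrightarrow> (j' has_real_derivative j'' x) (at x)"
    and ineq: "\<And>x. x \<in> {0<..<r} \<Longrightarrow> - (K * j x) \<le> j'' x"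
    and x: "x \<in> {0<..r}"
  shows "j x * (1 - K / 2 * r\<^sup>2) \<le> x * j' r"
proof -
  \<comment> \<open>the continuous extension of \<open>j\<close> to the origin\<close>
  define i where "i x = (if x \<le> 0 then 0 else j x)" for x
  have ij: "i y = j y" if "y > 0" for y using that by (simp add: i_def)
  have at0: "(i \<longlongrightarrow> 0) (at_right 0)"
    by (rule Lim_transform_eventually[OF lim]) (auto simp: i_def eventually_at_filter)
  have ci: "continuous_on {0..r} i"
    unfolding continuous_on_eq_continuous_within
  proof
    fix y assume y: "y \<in> {0..r}"
    show "continuous (at y within {0..r}) i"
    proof (cases "y = 0")
      case True
      have "at 0 within {0..r} = at_right 0"
        using r by (metis at_within_Icc_at_right)
      then show ?thesis using at0 True by (simp add: continuous_within i_def)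
    next
      case False
      have e: "at y within {0..r} = at y within {0<..r}"
        using False y by (intro at_within_nhd[where S="{0<..}"]) auto
      have "continuous (at y within {0<..r}) j"
        using cj y False by (auto simp: continuous_on_eq_continuous_within)
      then have "continuous (at y within {0<..r}) i"
        by (rule continuous_transform_within[where \<delta>=1]) (use y False in \<open>auto simp: i_def\<close>)
      then show ?thesis by (simp add: e)
    qed
  qed
  define F where "F y = integral {0..y} i" for y
  have F: "(F has_real_derivative i y) (at y within {0..r})" if "y \<in> {0..r}" for y
    unfolding F_def has_real_derivative_iff_has_vector_derivative
    by (rule integral_has_vector_derivative[OF ci that])
  have Fat: "(F has_real_derivative j y) (at y)" if "y \<in> {0<..<r}" for y
  proof -
    have "at y within {0..r} = at y" using that by (intro at_within_interior) auto
    then show ?thesis using F[of y] that ij by auto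
  qed
  have cF: "continuous_on {0..r} F"
    by (auto simp: continuous_on_eq_continuous_within intro!: DERIV_continuous F)
  have F0: "F 0 = 0" by (simp add: F_def)
  have i_nonneg: "i y \<ge> 0" if "y \<in> {0..r}" for y using pos that by (auto simp: i_def)
  have F_nonneg: "F y \<ge> 0" if "y \<in> {0..r}" for y
    unfolding F_def
    by (rule integral_nonneg)
       (use that in \<open>auto intro!: integrable_continuous_real continuous_on_subset[OF ci] i_nonneg\<close>)
  define m where "m = j' r + K * F r"
  have j'_le: "j' y \<le> m" if y: "y \<in> {0<..r}" for y
  proof -
    have "j' y + K * F y \<le> j' r + K * F r"
    proof (rule DERIV_nonneg_imp_increasing_open[of y r "\<lambda>a. j' a + K * F a"])
      show "y \<le> r" using y by auto
      show "\<exists>d. ((\<lambda>a. j' a + K * F a) has_real_derivative d) (at z) \<and> 0 \<le> d" if "y < z" "z < r" for z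
        using d2[of z] Fat[of z] ineq[of z] that y
        by (intro exI[of _ "j'' z + K * j z"]) (auto intro!: derivative_eq_intros)
      show "continuous_on {y..r} (\<lambda>a. j' a + K * F a)"
        using y by (intro continuous_intros continuous_on_subset[OF cj'] continuous_on_subset[OF cF]) auto
    qed
    moreover have "K * F y \<ge> 0" using K F_nonneg[of y] y by auto
    ultimately show ?thesis by (simp add: m_def)
  qed
  have j_le: "i y \<le> m * y" if y: "y \<in> {0..r}" for y
  proof -
    have "m * 0 - i 0 \<le> m * y - i y"
    proof (rule DERIV_nonneg_imp_increasing_open[of 0 y "\<lambda>a. m * a - i a"])
      show "\<exists>d. ((\<lambda>a. m * a - i a) has_real_derivative d) (at z) \<and> 0 \<le> d" if z: "0 < z" "z < y" for z
      proof -
        have "(j has_real_derivative j' z) (at z)" using d1 z y by auto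
        then have "(i has_real_derivative j' z) (at z)"
          by (rule has_field_derivative_transform_within_open[where S="{0<..}"])
             (use z in \<open>auto simp: i_def\<close>)
        then show ?thesis using j'_le[of z] z y
          by (intro exI[of _ "m - j' z"]) (auto intro!: derivative_eq_intros)
      qed
      show "continuous_on {0..y} (\<lambda>a. m * a - i a)"
        using y by (intro continuous_intros continuous_on_subset[OF ci]) auto
    qed (use y in auto)
    then show ?thesis by (simp add: i_def)
  qed
  have F_le: "F r \<le> m * r\<^sup>2 / 2"
  proof -
    have "m * 0\<^sup>2 / 2 - F 0 \<le> m * r\<^sup>2 / 2 - F r"
    proof (rule DERIV_nonneg_imp_increasing_open[of 0 r "\<lambda>a. m * a\<^sup>2 / 2 - F a"])
      show "\<exists>d. ((\<lambda>a. m * a\<^sup>2 / 2 - F a) has_real_derivative d) (at z) \<and> 0 \<le> d" if z: "0 < z" "z < r" for z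
        using Fat[of z] j_le[of z] ij z
        by (intro exI[of _ "m * z - j z"]) (auto intro!: derivative_eq_intros)
      show "continuous_on {0..r} (\<lambda>a. m * a\<^sup>2 / 2 - F a)"
        by (intro continuous_intros cF) auto
    qed (use r in auto)
    then show ?thesis by (simp add: F0)
  qed
  have "K * F r \<le> K * (m * r\<^sup>2 / 2)" using F_le K by (rule mult_left_mono)
  then have "m * (1 - K / 2 * r\<^sup>2) \<le> j' r" by (simp add: m_def algebra_simps)
  then have "x * (m * (1 - K / 2 * r\<^sup>2)) \<le> x * j' r" using x by (intro mult_left_mono) auto
  moreover have "j x * (1 - K / 2 * r\<^sup>2) \<le> (m * x) * (1 - K / 2 * r\<^sup>2)"
    using j_le[of x] x ij[of x] small by (intro mult_right_mono) auto
  ultimately show ?thesis by (simp add: algebra_simps)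
qed

section \<open>Area of the image of a plane map\<close>

text \<open>The change of variables inequality of \<open>integral_on_image_ubound\<close>, carried over from
  \<open>real ^ 2\<close> to \<open>real \<times> real\<close> by the coordinate isomorphism, which maps boxes to boxes of equal
  content. The columns \<open>p\<close> and \<open>q\<close> of the Jacobian matrix are the partial derivatives of \<open>\<Phi>\<close>.\<close>

lemma integral_image_le_plane:
  fixes f :: "real \<times> real \<Rightarrow> real" and \<Phi> p q :: "real \<times> real \<Rightarrow> real \<times> real"
  assumes nonneg: "\<And>x. x \<in> S \<Longrightarrow> 0 \<le> f (\<Phi> x)"
    and der: "\<And>x. x \<in> S \<Longrightarrow> (\<Phi> has_derivative (\<lambda>h. fst h *\<^sub>R p x + snd h *\<^sub>R q x)) (at x within S)"
    and bounded: "bounded S" "bounded (\<Phi> ` S)"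
    and f_int: "f integrable_on \<Phi> ` S"
    and int: "(\<lambda>x. \<bar>fst (p x) * snd (q x) - snd (p x) * fst (q x)\<bar> * f (\<Phi> x)) integrable_on S"
  shows "integral (\<Phi> ` S) f
           \<le> integral S (\<lambda>x. \<bar>fst (p x) * snd (q x) - snd (p x) * fst (q x)\<bar> * f (\<Phi> x))"
proof -
  define toV :: "real \<times> real \<Rightarrow> real ^ 2" where "toV = (\<lambda>x. vector [fst x, snd x])"
  define toP :: "real ^ 2 \<Rightarrow> real \<times> real" where "toP = (\<lambda>v. (v $ 1, v $ 2))"
  have inv [simp]: "toP (toV x) = x" "toV (toP v) = v" for x v
    by (simp_all add: toV_def toP_def vec_eq_iff forall_2)
  have imV: "toV ` A = {v. toP v \<in> A}" for A
    using image_iff by fastforce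
  have imP: "toP ` A = {x. toV x \<in> A}" for A
    using image_iff by fastforce
  have blP: "bounded_linear toP"
    unfolding toP_def by (intro bounded_linear_Pair bounded_linear_vec_nth)
  have blV: "bounded_linear toV"
    by (rule linear_linear[THEN iffD2], rule linearI) (simp_all add: toV_def vec_eq_iff forall_2)
  have boxP: "toP ` cbox u v = cbox (u $ 1, u $ 2) (v $ 1, v $ 2)" for u v
    unfolding imP by (auto simp: toV_def mem_box_cart forall_2)
  have boxV: "toV ` cbox a b = cbox (toV a) (toV b)" for a b
    unfolding imV by (cases a; cases b) (auto simp: toV_def toP_def mem_box_cart forall_2)
  have content: "measure lborel (toP ` cbox u v) = 1 * measure lborel (cbox u v)" for u v
  proof (cases "cbox u v = {}")
    case True
    then show ?thesis by simp
  next
    case False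
    then have "u $ 1 \<le> v $ 1" "u $ 2 \<le> v $ 2"
      by (auto simp: interval_ne_empty_cart forall_2)
    then show ?thesis
      unfolding boxP using False
      by (simp add: content_cbox_cart content_Pair UNIV_2)
  qed
  have transfer: "((\<lambda>v. h (toP v)) has_integral y) (toV ` T)"
    if h: "(h has_integral y) T" and T: "bounded T" for h :: "real \<times> real \<Rightarrow> real" and y T
  proof -
    obtain b where b: "T \<subseteq> cbox (- b) b"
      using bounded_subset_cbox_symmetric[OF T] .
    have "((\<lambda>x. if x \<in> T then h x else 0) has_integral y) (cbox (- b) b)"
      using has_integral_restrict[OF b, of h y] h by simp
    then have "((\<lambda>v. if toP v \<in> T then h (toP v) else 0) has_integral (1 / 1) *\<^sub>R y) (toV ` cbox (- b) b)"
      by (rule has_integral_twiddle[where g = toP and h = toV and r = 1, rotated -1])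
         (use boxP boxV content linear_continuous_at[OF blP] in auto)
    then have "((\<lambda>v. if v \<in> toV ` T then h (toP v) else 0) has_integral y) (toV ` cbox (- b) b)"
      unfolding imV by simp
    then show ?thesis
      using has_integral_restrict[of "toV ` T" "toV ` cbox (- b) b" "\<lambda>v. h (toP v)" y] b by blast
  qed
  define D where "D x = fst (p x) * snd (q x) - snd (p x) * fst (q x)" for x
  define G where "G = (\<lambda>v. toV (\<Phi> (toP v)))"
  define G' where "G' v = (\<lambda>h. toV (fst (toP h) *\<^sub>R p (toP v) + snd (toP h) *\<^sub>R q (toP v)))" for v
  have det: "det (matrix (G' v)) = D (toP v)" for v
    by (simp add: det_2 matrix_def G'_def D_def toV_def toP_def axis_def)
  have G: "(G has_derivative G' v) (at v within toV ` S)" if v: "v \<in> toV ` S" for v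
  proof -
    have *: "toP ` toV ` S = S" by (simp add: image_image)
    have "toP v \<in> S" using v by auto
    from has_derivative_in_compose[OF bounded_linear_imp_has_derivative[OF blP], of \<Phi> _ v "toV ` S",
        unfolded *, OF der[OF this]]
    have "((\<lambda>v. \<Phi> (toP v)) has_derivative
        (\<lambda>h. fst (toP h) *\<^sub>R p (toP v) + snd (toP h) *\<^sub>R q (toP v))) (at v within toV ` S)" .
    from bounded_linear.has_derivative[OF blV this]
    show ?thesis unfolding G_def G'_def .
  qed
  have im: "G ` toV ` S = toV ` \<Phi> ` S" by (simp add: G_def image_image)
  have int': "((\<lambda>v. \<bar>D (toP v)\<bar> * f (\<Phi> (toP v))) has_integral integral S (\<lambda>x. \<bar>D x\<bar> * f (\<Phi> x))) (toV ` S)"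
    using transfer[OF _ bounded(1), of "\<lambda>x. \<bar>D x\<bar> * f (\<Phi> x)"] int by (auto simp: D_def integrable_integral)
  have "integral (\<Phi> ` S) f = integral (G ` toV ` S) (\<lambda>v. f (toP v))"
    unfolding im using transfer[OF integrable_integral[OF f_int] bounded(2)] by (rule integral_unique[symmetric])
  also have "\<dots> \<le> integral (toV ` S) (\<lambda>v. \<bar>det (matrix (G' v))\<bar> * f (toP (G v)))"
    by (rule integral_on_image_ubound[OF _ G])
       (use nonneg int' in \<open>auto simp: det G_def intro: has_integral_integrable\<close>)
  also have "\<dots> = integral S (\<lambda>x. \<bar>D x\<bar> * f (\<Phi> x))"
    using int' by (simp add: det G_def integral_unique)
  finally show ?thesis by (simp add: D_def)
qed

section \<open>Parametrizations of the circle\<close>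

text \<open>The angle is the integral of the angular velocity \<open>\<omega> = x y' - y x'\<close>. A unit vector
  \<open>(x, y)\<close> satisfies \<open>(x', y') = \<omega> (-y, x)\<close>, so its inner product with \<open>(cos \<theta>, sin \<theta>)\<close> and the
  corresponding determinant are constant.\<close>

lemma angle_function:
  fixes \<gamma> \<gamma>' :: "real \<Rightarrow> real \<times> real"
  assumes ab: "a \<le> b"
    and d: "\<And>t. t \<in> {a..b} \<Longrightarrow> (\<gamma> has_vector_derivative \<gamma>' t) (at t within {a..b})"
    and c: "continuous_on {a..b} \<gamma>'"
    and unit: "\<And>t. t \<in> {a..b} \<Longrightarrow> (fst (\<gamma> t))\<^sup>2 + (snd (\<gamma> t))\<^sup>2 = 1"
  obtains \<theta> \<theta>' where "continuous_on {a..b} \<theta>'"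
    "\<And>t. t \<in> {a..b} \<Longrightarrow> (\<theta> has_real_derivative \<theta>' t) (at t within {a..b})"
    "\<And>t. t \<in> {a..b} \<Longrightarrow> \<gamma> t = (cos (\<theta> t), sin (\<theta> t))"
proof -
  define x y x' y' where "x = (\<lambda>t. fst (\<gamma> t))" and "y = (\<lambda>t. snd (\<gamma> t))"
    and "x' = (\<lambda>t. fst (\<gamma>' t))" and "y' = (\<lambda>t. snd (\<gamma>' t))"
  have dx: "(x has_real_derivative x' t) (at t within {a..b})" if "t \<in> {a..b}" for t
    using bounded_linear.has_vector_derivative[OF bounded_linear_fst d[OF that]]
    by (simp add: x_def x'_def has_real_derivative_iff_has_vector_derivative)
  have dy: "(y has_real_derivative y' t) (at t within {a..b})" if "t \<in> {a..b}" for t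
    using bounded_linear.has_vector_derivative[OF bounded_linear_snd d[OF that]]
    by (simp add: y_def y'_def has_real_derivative_iff_has_vector_derivative)
  have xy: "(x t)\<^sup>2 + (y t)\<^sup>2 = 1" if "t \<in> {a..b}" for t
    using unit[OF that] by (simp add: x_def y_def)
  have cxy: "continuous_on {a..b} x" "continuous_on {a..b} y"
    by (auto simp: continuous_on_eq_continuous_within intro!: DERIV_continuous dx dy)
  define \<omega> where "\<omega> t = x t * y' t - y t * x' t" for t
  have c\<omega>: "continuous_on {a..b} \<omega>"
    unfolding \<omega>_def x'_def y'_def by (intro continuous_intros cxy c)
  obtain \<theta>\<^sub>0 where \<theta>\<^sub>0: "x a = cos \<theta>\<^sub>0" "y a = sin \<theta>\<^sub>0"
    using sincos_total_2pi[OF xy[of a]] ab by auto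
  define \<theta> where "\<theta> t = \<theta>\<^sub>0 + integral {a..t} \<omega>" for t
  have d\<theta>: "(\<theta> has_real_derivative \<omega> t) (at t within {a..b})" if "t \<in> {a..b}" for t
    using integral_has_real_derivative[OF c\<omega> that] unfolding \<theta>_def
    by (auto intro!: derivative_eq_intros)
  have "x t = cos (\<theta> t) \<and> y t = sin (\<theta> t)" if t: "t \<in> {a..b}" for t
  proof -
    \<comment> \<open>an interval reduced to a point carries no derivative, whence the condition \<open>a < b\<close>\<close>
    have orth: "x s * x' s + y s * y' s = 0" if s: "s \<in> {a..b}" and "a < b" for s
    proof -
      have 1: "((\<lambda>s. (x s)\<^sup>2 + (y s)\<^sup>2) has_vector_derivative 2 * x s * x' s + 2 * y s * y' s) (at s within {a..b})"
        unfolding has_real_derivative_iff_has_vector_derivative[symmetric]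
        using dx[OF s] dy[OF s] by (auto intro!: derivative_eq_intros)
      have "((\<lambda>s. (x s)\<^sup>2 + (y s)\<^sup>2) has_vector_derivative 0) (at s within {a..b})"
        by (rule has_vector_derivative_transform[OF s _ has_vector_derivative_const[of 1]]) (use xy in auto)
      with 1 show ?thesis
        using vector_derivative_unique_within_closed_interval[OF \<open>a < b\<close>, of s] s by fastforce
    qed
    have rot: "x' s = - \<omega> s * y s \<and> y' s = \<omega> s * x s" if s: "s \<in> {a..b}" and "a < b" for s
    proof -
      have "- \<omega> s * y s = x' s * ((x s)\<^sup>2 + (y s)\<^sup>2) - x s * (x s * x' s + y s * y' s)"
        "\<omega> s * x s = y' s * ((x s)\<^sup>2 + (y s)\<^sup>2) - y s * (x s * x' s + y s * y' s)"
        by (simp_all add: \<omega>_def algebra_simps power2_eq_square)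
      then show ?thesis using orth[OF that] xy[OF s] by simp
    qed
    have const: "g t = g a" if g: "\<And>s. s \<in> {a..b} \<Longrightarrow> a < b \<Longrightarrow> (g has_real_derivative 0) (at s within {a..b})"
      for g :: "real \<Rightarrow> real"
    proof (cases "a < b")
      case True
      then obtain k where "\<And>s. s \<in> {a..b} \<Longrightarrow> g s = k"
        using has_field_derivative_zero_constant[of "{a..b}" g] g by auto
      then show ?thesis using t by auto
    next
      case False
      then have "t = a" using t by auto
      then show ?thesis by simp
    qed
    have p: "x t * cos (\<theta> t) + y t * sin (\<theta> t) = x a * cos (\<theta> a) + y a * sin (\<theta> a)"
    proof (rule const)
      fix s assume s: "s \<in> {a..b}" "a < b"
      show "((\<lambda>t. x t * cos (\<theta> t) + y t * sin (\<theta> t)) has_real_derivative 0) (at s within {a..b})"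
        by (rule derivative_eq_intros dx dy d\<theta> s refl)+ (use rot[OF s] in \<open>simp add: algebra_simps\<close>)
    qed
    have q: "y t * cos (\<theta> t) - x t * sin (\<theta> t) = y a * cos (\<theta> a) - x a * sin (\<theta> a)"
    proof (rule const)
      fix s assume s: "s \<in> {a..b}" "a < b"
      show "((\<lambda>t. y t * cos (\<theta> t) - x t * sin (\<theta> t)) has_real_derivative 0) (at s within {a..b})"
        by (rule derivative_eq_intros dx dy d\<theta> s refl)+ (use rot[OF s] in \<open>simp add: algebra_simps\<close>)
    qed
    have "\<theta> a = \<theta>\<^sub>0" by (simp add: \<theta>_def)
    then have pq: "x t * cos (\<theta> t) + y t * sin (\<theta> t) = 1" "y t * cos (\<theta> t) - x t * sin (\<theta> t) = 0"
      using p q \<theta>\<^sub>0 by (simp_all add: power2_eq_square[symmetric])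
    let ?c = "cos (\<theta> t)" and ?s = "sin (\<theta> t)"
    have cs: "?c * ?c + ?s * ?s = 1" by (simp add: power2_eq_square[symmetric])
    show ?thesis
      using pq cs by (intro conjI) algebra+
  qed
  then have "\<gamma> t = (cos (\<theta> t), sin (\<theta> t))" if "t \<in> {a..b}" for t
    using that by (auto simp: x_def y_def prod_eq_iff)
  with c\<omega> d\<theta> show ?thesis by (rule that)
qed

lemma integral_periodic_shift:
  fixes g :: "real \<Rightarrow> real"
  assumes c: "continuous_on UNIV g" and per: "\<And>t. g (t + p) = g t" and p: "p \<ge> 0"
  shows "integral {a..a + p} g = integral {0..p} g"
proof -
  define lo hi where "lo = min a 0" and "hi = max a 0"
  obtain G where G: "\<And>t. t \<in> {lo - 1..hi + p + 1} \<Longrightarrow> (G has_vector_derivative g t) (at t within {lo - 1..hi + p + 1})"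
    using antiderivative_continuous[of "lo - 1" "hi + p + 1" g] c continuous_on_subset by blast
  have G': "(G has_real_derivative g t) (at t)" if "t \<in> {lo..hi + p}" for t
  proof -
    have "at t within {lo - 1..hi + p + 1} = at t" using that by (intro at_within_interior) auto
    then show ?thesis using G[of t] that by (auto simp: has_real_derivative_iff_has_vector_derivative)
  qed
  have int: "integral {t..t + p} g = G (t + p) - G t" if "t \<in> {lo..hi}" for t
    by (rule integral_unique, rule fundamental_theorem_of_calculus)
       (use that p in \<open>auto simp: has_real_derivative_iff_has_vector_derivative[symmetric]
          intro!: has_field_derivative_at_within G'\<close>)
  have "((\<lambda>t. G (t + p) - G t) has_real_derivative 0) (at t within {lo..hi})" if t: "t \<in> {lo..hi}" for t
  proof -
    have "((\<lambda>t. G (t + p)) has_real_derivative g (t + p)) (at t)"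
      using G'[of "t + p"] t p by (intro DERIV_shift[THEN iffD1]) auto
    from DERIV_diff[OF this G'[of t]] t p per[of t]
    show ?thesis by (auto intro: has_field_derivative_at_within)
  qed
  then obtain k where k: "G (t + p) - G t = k" if "t \<in> {lo..hi}" for t
    using has_field_derivative_zero_constant[of "{lo..hi}" "\<lambda>t. G (t + p) - G t"] by auto
  then have "integral {a..a + p} g = k" "integral {0..0 + p} g = k"
    using int[of a] int[of 0] k[of a] k[of 0] by (auto simp: lo_def hi_def)
  then show ?thesis by simp
qed

text \<open>An injective parametrization cannot turn around the circle more than once: otherwise \<open>\<theta>\<close>
  would reach \<open>\<theta>(0) + 2\<pi>\<close> before time \<open>2\<pi>\<close>. Hence \<open>\<theta>\<close> covers at most one period of \<open>g\<close>.\<close>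

lemma integral_substitution_injective_circle_mono:
  fixes g \<theta> \<theta>' :: "real \<Rightarrow> real"
  assumes g: "continuous_on UNIV g" and g0: "\<And>t. g t \<ge> 0" and per: "\<And>t. g (t + 2 * pi) = g t"
    and d: "\<And>t. t \<in> {0..2 * pi} \<Longrightarrow> (\<theta> has_real_derivative \<theta>' t) (at t within {0..2 * pi})"
    and pos: "\<And>t. t \<in> {0..2 * pi} \<Longrightarrow> 0 \<le> \<theta>' t"
    and inj: "inj_on (\<lambda>t. (cos (\<theta> t), sin (\<theta> t))) {0..<2 * pi}"
  shows "integral {0..2 * pi} (\<lambda>t. g (\<theta> t) * \<theta>' t) \<le> integral {0..2 * pi} g"
proof -
  have c\<theta>: "continuous_on {0..2 * pi} \<theta>"
    by (auto simp: continuous_on_eq_continuous_within intro!: DERIV_continuous d)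
  have mono: "\<theta> s \<le> \<theta> t" if "0 \<le> s" "s \<le> t" "t \<le> 2 * pi" for s t
  proof (rule DERIV_nonneg_imp_increasing_open[of s t \<theta>])
    show "\<exists>y. (\<theta> has_real_derivative y) (at x) \<and> 0 \<le> y" if x: "s < x" "x < t" for x
    proof -
      have "at x within {0..2 * pi} = at x" using that \<open>0 \<le> s\<close> \<open>t \<le> 2 * pi\<close> by (intro at_within_interior) auto
      then show ?thesis using d[of x] pos[of x] that \<open>0 \<le> s\<close> \<open>t \<le> 2 * pi\<close> by auto
    qed
  qed (use that in \<open>auto intro: continuous_on_subset[OF c\<theta>]\<close>)
  have le: "\<theta> (2 * pi) \<le> \<theta> 0 + 2 * pi"
  proof (rule ccontr)
    assume *: "\<not> ?thesis"
    then obtain t where t: "0 \<le> t" "t \<le> 2 * pi" "\<theta> t = \<theta> 0 + 2 * pi"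
      using IVT'[of \<theta> 0 "\<theta> 0 + 2 * pi" "2 * pi", OF _ _ _ c\<theta>] by auto
    with * have "t \<noteq> 2 * pi" "t \<noteq> 0" by auto
    moreover have "(cos (\<theta> t), sin (\<theta> t)) = (cos (\<theta> 0), sin (\<theta> 0))" by (simp add: t)
    ultimately show False using inj t unfolding inj_on_def by force
  qed
  obtain G where G: "\<And>t. t \<in> {\<theta> 0..\<theta> (2 * pi)} \<Longrightarrow> (G has_vector_derivative g t) (at t within {\<theta> 0..\<theta> (2 * pi)})"
    using antiderivative_continuous[of "\<theta> 0" "\<theta> (2 * pi)" g] g continuous_on_subset by blast
  have im: "\<theta> ` {0..2 * pi} \<subseteq> {\<theta> 0..\<theta> (2 * pi)}" using mono by auto
  have "((\<lambda>t. g (\<theta> t) * \<theta>' t) has_integral G (\<theta> (2 * pi)) - G (\<theta> 0)) {0..2 * pi}"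
  proof (rule fundamental_theorem_of_calculus)
    fix t :: real assume t: "t \<in> {0..2 * pi}"
    have "(G has_real_derivative g (\<theta> t)) (at (\<theta> t) within \<theta> ` {0..2 * pi})"
      unfolding has_real_derivative_iff_has_vector_derivative
      by (rule has_vector_derivative_within_subset[OF G im]) (use mono[of 0 t] mono[of t "2 * pi"] t in auto)
    from DERIV_image_chain[OF this d[OF t]]
    show "((\<lambda>t. G (\<theta> t)) has_vector_derivative g (\<theta> t) * \<theta>' t) (at t within {0..2 * pi})"
      by (simp add: o_def has_real_derivative_iff_has_vector_derivative)
  qed simp
  moreover have "(g has_integral G (\<theta> (2 * pi)) - G (\<theta> 0)) {\<theta> 0..\<theta> (2 * pi)}"
    by (rule fundamental_theorem_of_calculus) (use G mono in auto)
  ultimately have "integral {0..2 * pi} (\<lambda>t. g (\<theta> t) * \<theta>' t) = integral {\<theta> 0..\<theta> (2 * pi)} g"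
    by (simp add: integral_unique)
  also have "\<dots> \<le> integral {\<theta> 0..\<theta> 0 + 2 * pi} g"
    by (rule integral_subset_le)
       (use le g0 in \<open>auto intro!: integrable_continuous_real continuous_on_subset[OF g]\<close>)
  also have "\<dots> = integral {0..2 * pi} g"
    by (rule integral_periodic_shift[of g "2 * pi", OF g per]) simp
  finally show ?thesis .
qed

text \<open>A derivative without zeros on \<open>[0, 2\<pi>)\<close> has a constant sign. A clockwise angle reduces
  to the counterclockwise case by reflecting \<open>\<theta>\<close> and \<open>g\<close>.\<close>

lemma integral_substitution_injective_circle:
  fixes g \<theta> \<theta>' :: "real \<Rightarrow> real"
  assumes g: "continuous_on UNIV g" and g0: "\<And>t. g t \<ge> 0" and per: "\<And>t. g (t + 2 * pi) = g t"
    and d: "\<And>t. t \<in> {0..2 * pi} \<Longrightarrow> (\<theta> has_real_derivative \<theta>' t) (at t within {0..2 * pi})"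
    and c: "continuous_on {0..2 * pi} \<theta>'"
    and nz: "\<And>t. t \<in> {0..<2 * pi} \<Longrightarrow> \<theta>' t \<noteq> 0"
    and inj: "inj_on (\<lambda>t. (cos (\<theta> t), sin (\<theta> t))) {0..<2 * pi}"
  shows "integral {0..2 * pi} (\<lambda>t. g (\<theta> t) * \<bar>\<theta>' t\<bar>) \<le> integral {0..2 * pi} g"
proof -
  have sign: "0 < \<theta>' 0 * \<theta>' t" if t: "t \<in> {0..<2 * pi}" for t
  proof (rule ccontr)
    assume "\<not> ?thesis"
    moreover have "0 \<le> \<theta>' 0 * \<theta>' 0" by simp
    moreover have "continuous_on {0..t} (\<lambda>t. \<theta>' 0 * \<theta>' t)"
      using t by (intro continuous_intros continuous_on_subset[OF c]) auto
    ultimately obtain s where "0 \<le> s" "s \<le> t" "\<theta>' 0 * \<theta>' s = 0"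
      using IVT2'[of "\<lambda>t. \<theta>' 0 * \<theta>' t" t 0 0] t by auto
    then show False using nz[of s] nz[of 0] t by auto
  qed
  have sign': "0 \<le> \<theta>' 0 * \<theta>' t" if t: "t \<in> {0..2 * pi}" for t
  proof (rule continuous_ge_on_closure[of "{0..<2 * pi}" "\<lambda>t. \<theta>' 0 * \<theta>' t"])
    show "continuous_on (closure {0..<2 * pi}) (\<lambda>t. \<theta>' 0 * \<theta>' t)"
      by (auto intro!: continuous_intros c)
    show "t \<in> closure {0..<2 * pi}" using t by auto
  qed (use sign less_imp_le in blast)
  have 0: "\<theta>' 0 \<noteq> 0" using nz[of 0] by simp
  show ?thesis
  proof (cases "\<theta>' 0 > 0")
    case True
    then have "0 \<le> \<theta>' t" if "t \<in> {0..2 * pi}" for t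
      using sign'[OF that] by (simp add: zero_le_mult_iff)
    moreover from this have "integral {0..2 * pi} (\<lambda>t. g (\<theta> t) * \<bar>\<theta>' t\<bar>) = integral {0..2 * pi} (\<lambda>t. g (\<theta> t) * \<theta>' t)"
      by (intro integral_cong) auto
    ultimately show ?thesis
      using integral_substitution_injective_circle_mono[OF g g0 per d _ inj] by simp
  next
    case False
    then have neg: "\<theta>' t \<le> 0" if "t \<in> {0..2 * pi}" for t
      using sign'[OF that] 0 by (simp add: zero_le_mult_iff)
    have "integral {0..2 * pi} (\<lambda>t. g (- (- \<theta> t)) * (- \<theta>' t)) \<le> integral {0..2 * pi} (\<lambda>t. g (- t))"
    proof (rule integral_substitution_injective_circle_mono)
      show "continuous_on UNIV (\<lambda>t. g (- t))"
        by (intro continuous_on_compose2[OF g] continuous_intros) auto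
      show "g (- (t + 2 * pi)) = g (- t)" for t
        using per[of "- (t + 2 * pi)"] by simp
      show "inj_on (\<lambda>t. (cos (- \<theta> t), sin (- \<theta> t))) {0..<2 * pi}"
        using inj by (auto simp: inj_on_def)
      show "((\<lambda>t. - \<theta> t) has_real_derivative - \<theta>' t) (at t within {0..2 * pi})" if "t \<in> {0..2 * pi}" for t
        using d[OF that] by (rule DERIV_minus)
    qed (use g0 neg in auto)
    also have "integral {0..2 * pi} (\<lambda>t. g (- t)) = integral {- (2 * pi)..- (2 * pi) + 2 * pi} g"
      using Henstock_Kurzweil_Integration.integral_reflect_real[of "2 * pi" 0 "\<lambda>t. g (- t)"] by simp
    also have "\<dots> = integral {0..2 * pi} g"
      by (rule integral_periodic_shift[of g "2 * pi", OF g per]) simp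
    finally have "integral {0..2 * pi} (\<lambda>t. g (\<theta> t) * (- \<theta>' t)) \<le> integral {0..2 * pi} g" by simp
    moreover have "integral {0..2 * pi} (\<lambda>t. g (\<theta> t) * \<bar>\<theta>' t\<bar>) = integral {0..2 * pi} (\<lambda>t. g (\<theta> t) * (- \<theta>' t))"
      using neg by (intro integral_cong) auto
    ultimately show ?thesis by simp
  qed
qed

section \<open>Geodesic frames and the Jacobi equation\<close>

text \<open>A sufficient condition for the derivative within \<open>S\<close> at \<open>x\<close> to be unique. It holds at
  interior points and on the edges of the polar rectangle.\<close>

definition axis_accessible :: "real \<times> real \<Rightarrow> (real \<times> real) set \<Rightarrow> bool" where
  "axis_accessible x S \<longleftrightarrow>
     (\<forall>i\<in>Basis. \<forall>\<epsilon>>0. \<exists>d. 0 < \<bar>d\<bar> \<and> \<bar>d\<bar> < \<epsilon> \<and> x + d *\<^sub>R i \<in> S)"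

lemma axis_accessible_interior:
  assumes "x \<in> interior S"
  shows "axis_accessible x S"
  unfolding axis_accessible_def
proof (intro ballI allI impI)
  fix i :: "real \<times> real" and \<epsilon> :: real assume i: "i \<in> Basis" and \<epsilon>: "\<epsilon> > 0"
  obtain \<delta> where \<delta>: "\<delta> > 0" "ball x \<delta> \<subseteq> S"
    using assms by (auto simp: mem_interior)
  have "x + (min \<delta> \<epsilon> / 2) *\<^sub>R i \<in> ball x \<delta>"
    using \<delta> \<epsilon> i by (auto simp: dist_norm)
  then show "\<exists>d. 0 < \<bar>d\<bar> \<and> \<bar>d\<bar> < \<epsilon> \<and> x + d *\<^sub>R i \<in> S"
    using \<delta> \<epsilon> by (intro exI[of _ "min \<delta> \<epsilon> / 2"]) auto
qed

lemma axis_accessible_polar_rect: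
  assumes "x \<in> polar_rect r"
  shows "axis_accessible x (polar_rect r)"
  unfolding axis_accessible_def
proof (intro ballI allI impI)
  fix i :: "real \<times> real" and \<epsilon> :: real assume i: "i \<in> Basis" and \<epsilon>: "\<epsilon> > 0"
  obtain \<rho> \<phi> where x: "x = (\<rho>, \<phi>)" by fastforce
  have b: "0 < \<rho>" "\<rho> \<le> r" "0 \<le> \<phi>" "\<phi> \<le> 2 * pi" using assms by (auto simp: x polar_rect_def)
  consider "i = (1, 0)" | "i = (0, 1)" using i by (auto simp: Basis_prod_def)
  then show "\<exists>d. 0 < \<bar>d\<bar> \<and> \<bar>d\<bar> < \<epsilon> \<and> x + d *\<^sub>R i \<in> polar_rect r"
  proof cases
    case 1
    define d where "d = min \<rho> \<epsilon> / 2"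
    have "0 < d" "d < \<rho>" "d < \<epsilon>" using b \<epsilon> by (auto simp: d_def)
    then show ?thesis using b 1 by (intro exI[of _ "- d"]) (auto simp: x polar_rect_def)
  next
    case 2
    show ?thesis
    proof (cases "\<phi> = 0")
      case True
      define d where "d = min pi \<epsilon> / 2"
      have "0 < d" "d < pi" "d < \<epsilon>" using pi_gt_zero \<epsilon> by (auto simp: d_def simp del: pi_gt_zero)
      then show ?thesis using b 2 True by (intro exI[of _ "d"]) (auto simp: x polar_rect_def)
    next
      case False
      define d where "d = min \<phi> \<epsilon> / 2"
      have "0 < d" "d < \<phi>" "d < \<epsilon>" using b False \<epsilon> by (auto simp: d_def)
      then show ?thesis using b 2 by (intro exI[of _ "- d"]) (auto simp: x polar_rect_def)
    qed
  qed
qed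

lemma C1_partials_unique:
  assumes f: "C1_partials f f\<^sub>1 f\<^sub>2 S" and x: "x \<in> S" "axis_accessible x S"
    and D: "(f has_derivative D) (at x within S)"
  shows "f\<^sub>1 x = D (1, 0)" and "f\<^sub>2 x = D (0, 1)"
proof -
  have "(\<lambda>h. fst h *\<^sub>R f\<^sub>1 x + snd h *\<^sub>R f\<^sub>2 x) = D"
    by (rule frechet_derivative_unique_within[OF C1_partialsD(1)[OF f x(1)] D])
       (use x(2) in \<open>auto simp: axis_accessible_def\<close>)
  then have "D h = fst h *\<^sub>R f\<^sub>1 x + snd h *\<^sub>R f\<^sub>2 x" for h by (simp add: fun_eq_iff)
  then show "f\<^sub>1 x = D (1, 0)" and "f\<^sub>2 x = D (0, 1)" by simp_all
qed

lemma C1_partials_dderiv: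
  assumes f: "C1_partials f f\<^sub>1 f\<^sub>2 S" and x: "x \<in> S" "axis_accessible x S"
  shows "dderiv S (1, 0) f x = f\<^sub>1 x" and "dderiv S (0, 1) f x = f\<^sub>2 x"
proof -
  have "(f has_derivative frechet_derivative f (at x within S)) (at x within S)"
    using C1_partialsD(1)[OF f x(1)] by (auto simp: differentiable_def frechet_derivative_works[symmetric])
  from C1_partials_unique[OF f x this]
  show "dderiv S (1, 0) f x = f\<^sub>1 x" and "dderiv S (0, 1) f x = f\<^sub>2 x"
    by (simp_all add: dderiv_def)
qed

lemma C1_partials_const:
  assumes f: "C1_partials f f\<^sub>1 f\<^sub>2 S" and x: "x \<in> S" "axis_accessible x S"
    and c: "\<And>y. y \<in> S \<Longrightarrow> f y = c"
  shows "f\<^sub>1 x = 0" and "f\<^sub>2 x = 0"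
proof -
  have "(f has_derivative (\<lambda>_. 0)) (at x within S)"
    by (rule has_derivative_transform[OF x(1) _ has_derivative_const]) (rule c)
  from C1_partials_unique[OF f x this] show "f\<^sub>1 x = 0" and "f\<^sub>2 x = 0" by simp_all
qed

lemma inner_const_partials:
  fixes f g :: "real \<times> real \<Rightarrow> real ^ 3"
  assumes f: "C1_partials f f\<^sub>1 f\<^sub>2 S" and g: "C1_partials g g\<^sub>1 g\<^sub>2 S"
    and x: "x \<in> S" "axis_accessible x S"
    and c: "\<And>y. y \<in> S \<Longrightarrow> f y \<bullet> g y = c"
  shows "f\<^sub>1 x \<bullet> g x = - (f x \<bullet> g\<^sub>1 x)" and "f\<^sub>2 x \<bullet> g x = - (f x \<bullet> g\<^sub>2 x)"
  using C1_partials_const[OF C1_partials_bilinear[OF bounded_bilinear_inner f g] x c] by simp_all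

lemma bounded_bilinear_cross3: "bounded_bilinear cross3"
  using bilinear_cross by (simp add: bilinear_conv_bounded_bilinear)

lemma orthonormal_expansion:
  fixes n Z v :: "real ^ 3"
  assumes "n \<bullet> n = 1" "Z \<bullet> Z = 1" "n \<bullet> Z = 0"
  shows "v = (v \<bullet> n) *\<^sub>R n + (v \<bullet> Z) *\<^sub>R Z + (v \<bullet> cross3 n Z) *\<^sub>R cross3 n Z"
proof -
  let ?T = "cross3 n Z"
  have T: "?T \<bullet> ?T = 1"
    using norm_cross_dot[of n Z] assms by (simp add: power_mult_distrib power2_norm_eq_inner)
  have o: "n \<bullet> ?T = 0" "Z \<bullet> ?T = 0" "?T \<bullet> n = 0" "?T \<bullet> Z = 0" "Z \<bullet> n = 0"
    using assms by (simp_all add: dot_cross_self inner_commute)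
  define w where "w = (v \<bullet> n) *\<^sub>R n + (v \<bullet> Z) *\<^sub>R Z + (v \<bullet> ?T) *\<^sub>R ?T"
  have w: "w \<bullet> n = v \<bullet> n" "w \<bullet> Z = v \<bullet> Z" "?T \<bullet> w = ?T \<bullet> v"
    unfolding w_def by (simp_all add: inner_add_left inner_add_right assms o T inner_commute[of _ v])
  have "cross3 ?T w = cross3 ?T v"
    using Lagrange[of w n Z] Lagrange[of v n Z] w cross_skew[of ?T w] cross_skew[of ?T v] by simp
  then have "v = w"
    using cross_dot_cancel[of ?T v w] T w by fastforce
  then show ?thesis by (simp add: w_def)
qed

lemma inner_cross_cross: "cross3 a b \<bullet> cross3 c d = (a \<bullet> c) * (b \<bullet> d) - (a \<bullet> d) * (b \<bullet> c)"
  by (simp add: cross3_simps)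

text \<open>The pointwise content of the Jacobi equation. Both sides are expanded in the orthonormal frame
  \<open>n\<close>, \<open>Z\<close>, \<open>T = n \<times> Z\<close>, in which \<open>V = J T\<close> and \<open>n\<^sub>1 \<times> Z = - (n\<^sub>1 \<bullet> T) n\<close>; each becomes, up to the
  factor \<open>J\<close>, the determinant \<open>(Z \<bullet> n\<^sub>2) (T \<bullet> n\<^sub>1) - (Z \<bullet> n\<^sub>1) (T \<bullet> n\<^sub>2)\<close>.\<close>

lemma jacobi_algebra:
  fixes n Z V n\<^sub>1 n\<^sub>2 Z\<^sub>2 :: "real ^ 3"
  assumes on: "n \<bullet> n = 1" "Z \<bullet> Z = 1" "n \<bullet> Z = 0"
    and V: "V \<bullet> n = 0" "V \<bullet> Z = 0" and n1: "n\<^sub>1 \<bullet> n = 0"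
    and l: "l = - (Z \<bullet> n\<^sub>1)" and m: "Z\<^sub>2 \<bullet> n = - (Z \<bullet> n\<^sub>2)"
  shows "(l * (n\<^sub>2 \<bullet> cross3 n Z) + Z\<^sub>2 \<bullet> cross3 n\<^sub>1 Z) * (V \<bullet> cross3 n Z)
           = - (cross3 Z V \<bullet> cross3 n\<^sub>1 n\<^sub>2)"
proof -
  define T where "T = cross3 n Z"
  define J where "J = V \<bullet> T"
  have VT: "V = J *\<^sub>R T"
    using orthonormal_expansion[OF on, of V] V by (simp add: J_def T_def)
  have TZ: "cross3 T Z = - n"
    using Lagrange[of Z n Z] on cross_skew[of T Z] by (simp add: T_def inner_commute)
  have "n\<^sub>1 = (n\<^sub>1 \<bullet> Z) *\<^sub>R Z + (n\<^sub>1 \<bullet> T) *\<^sub>R T"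
    using orthonormal_expansion[OF on, of n\<^sub>1] n1 by (simp add: T_def)
  then have "cross3 n\<^sub>1 Z = cross3 ((n\<^sub>1 \<bullet> Z) *\<^sub>R Z + (n\<^sub>1 \<bullet> T) *\<^sub>R T) Z" by (rule arg_cong)
  then have "cross3 n\<^sub>1 Z = - ((n\<^sub>1 \<bullet> T) *\<^sub>R n)"
    by (simp add: cross_add_left cross_mult_left TZ)
  then have a: "Z\<^sub>2 \<bullet> cross3 n\<^sub>1 Z = (n\<^sub>1 \<bullet> T) * (Z \<bullet> n\<^sub>2)" using m by simp
  have "cross3 Z V \<bullet> cross3 n\<^sub>1 n\<^sub>2 = J * ((Z \<bullet> n\<^sub>1) * (T \<bullet> n\<^sub>2) - (Z \<bullet> n\<^sub>2) * (T \<bullet> n\<^sub>1))"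
    unfolding inner_cross_cross by (subst (1 2) VT) (simp add: algebra_simps)
  then show ?thesis
    unfolding a l T_def[symmetric] J_def[symmetric] by (simp add: algebra_simps inner_commute)
qed

text \<open>A surface \<open>Y\<close> in polar coordinates whose metric is \<open>d\<rho>\<^sup>2 + |V|\<^sup>2 d\<phi>\<^sup>2\<close>, with radial
  derivative \<open>Z\<close>, angular derivative \<open>V\<close> and unit normal \<open>n\<close>; the index 1 marks derivatives in
  \<open>\<rho>\<close> and the index 2 those in \<open>\<phi>\<close>. The angular derivative is merely continuous, whereas \<open>l\<close>,
  the normal curvature of the radii, is required to be \<open>C\<^sup>1\<close>. The vector \<open>V\<close> may vanish at
  \<open>\<phi> = 2\<pi>\<close>, because the polar metric is positive on \<open>[0, 2\<pi>)\<close> only and \<open>\<Phi>\<close> need not close up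
  differentiably.\<close>

locale geodesic_frame =
  fixes r :: real and Y Z V Z\<^sub>1 Z\<^sub>2 n n\<^sub>1 n\<^sub>2 :: "real \<times> real \<Rightarrow> real ^ 3" and l l\<^sub>1 l\<^sub>2 :: "real \<times> real \<Rightarrow> real"
  assumes r: "r > 0"
    and Y: "C1_partials Y Z V (polar_rect r)"
    and Z: "C1_partials Z Z\<^sub>1 Z\<^sub>2 (polar_rect r)"
    and n: "C1_partials n n\<^sub>1 n\<^sub>2 (polar_rect r)"
    and l: "C1_partials l l\<^sub>1 l\<^sub>2 (polar_rect r)"
    and ZZ: "\<And>x. x \<in> polar_rect r \<Longrightarrow> Z x \<bullet> Z x = 1"
    and ZV: "\<And>x. x \<in> polar_rect r \<Longrightarrow> Z x \<bullet> V x = 0"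
    and nn: "\<And>x. x \<in> polar_rect r \<Longrightarrow> n x \<bullet> n x = 1"
    and nZ: "\<And>x. x \<in> polar_rect r \<Longrightarrow> n x \<bullet> Z x = 0"
    and nV: "\<And>x. x \<in> polar_rect r \<Longrightarrow> n x \<bullet> V x = 0"
    and V_nonzero: "\<And>\<rho> \<phi>. 0 < \<rho> \<Longrightarrow> \<rho> \<le> r \<Longrightarrow> 0 \<le> \<phi> \<Longrightarrow> \<phi> < 2 * pi \<Longrightarrow> V (\<rho>, \<phi>) \<noteq> 0"
    and Z1n: "\<And>x. x \<in> polar_rect r \<Longrightarrow> Z\<^sub>1 x \<bullet> n x = l x"
begin

text \<open>\<open>J\<close> is the signed area element; \<open>J\<^sub>1\<close> and \<open>J\<^sub>1\<^sub>1\<close> turn out to be its first and second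
  derivative in \<open>\<rho>\<close>.\<close>

definition J :: "real \<times> real \<Rightarrow> real" where "J x = V x \<bullet> cross3 (n x) (Z x)"
definition J\<^sub>1 :: "real \<times> real \<Rightarrow> real" where "J\<^sub>1 x = Z\<^sub>2 x \<bullet> cross3 (n x) (Z x)"
definition J\<^sub>1\<^sub>1 :: "real \<times> real \<Rightarrow> real" where
  "J\<^sub>1\<^sub>1 x = l x * (n\<^sub>2 x \<bullet> cross3 (n x) (Z x)) + Z\<^sub>2 x \<bullet> cross3 (n\<^sub>1 x) (Z x)"

lemma partial_orthogonality:
  assumes x: "x \<in> polar_rect r"
  shows "Z\<^sub>1 x \<bullet> Z x = 0" "Z\<^sub>2 x \<bullet> Z x = 0" "n\<^sub>1 x \<bullet> n x = 0" "n\<^sub>2 x \<bullet> n x = 0"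
    and "Z\<^sub>1 x \<bullet> n x = - (Z x \<bullet> n\<^sub>1 x)" "Z\<^sub>2 x \<bullet> n x = - (Z x \<bullet> n\<^sub>2 x)"
  using inner_const_partials[OF Z Z x axis_accessible_polar_rect[OF x] ZZ]
    inner_const_partials[OF n n x axis_accessible_polar_rect[OF x] nn]
    inner_const_partials[OF Z n x axis_accessible_polar_rect[OF x], of 0] nZ
  by (auto simp: inner_commute)

lemma continuous_J: "continuous_on (polar_rect r) J" "continuous_on (polar_rect r) J\<^sub>1"
  unfolding J_def J\<^sub>1_def
  using C1_partialsD(2-)[OF Y] C1_partialsD(2-)[OF Z] C1_partialsD(2-)[OF n]
  by (auto intro!: continuous_intros continuous_on_cross)

lemma J_squared:
  assumes x: "x \<in> polar_rect r"
  shows "(J x)\<^sup>2 = V x \<bullet> V x" and "V x = J x *\<^sub>R cross3 (n x) (Z x)"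
proof -
  show *: "V x = J x *\<^sub>R cross3 (n x) (Z x)"
    using orthonormal_expansion[OF nn[OF x] ZZ[OF x] nZ[OF x], of "V x"] nV[OF x] ZV[OF x]
    by (simp add: J_def inner_commute)
  have "V x \<bullet> V x = V x \<bullet> (J x *\<^sub>R cross3 (n x) (Z x))" using * by (rule arg_cong)
  then show "(J x)\<^sup>2 = V x \<bullet> V x" by (simp add: J_def power2_eq_square)
qed

text \<open>The angular derivative is not assumed to be differentiable; this is where it acquires a
  derivative in \<open>\<rho>\<close>, namely the angular derivative of \<open>Z = Y\<^sub>\<rho>\<close>.\<close>

lemma V_derivative:
  assumes x: "0 < a" "\<rho> \<in> {a..r}" "\<phi> \<in> {0..<2 * pi}"
  shows "((\<lambda>s. V (s, \<phi>)) has_vector_derivative Z\<^sub>2 (\<rho>, \<phi>)) (at \<rho> within {a..r})"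
proof (rule mixed_partials[where f = Y and f\<^sub>1 = Z and U = "{0..2 * pi}"])
  show "((\<lambda>s. Y (s, y)) has_vector_derivative Z (x, y)) (at x within {a..r})"
    if "x \<in> {a..r}" "y \<in> {0..2 * pi}" for x y
    by (rule C1_partials_D1[OF Y]) (use that x in \<open>auto simp: polar_rect_def\<close>)
  show "((\<lambda>s. Y (x, s)) has_vector_derivative V (x, y)) (at y within {0..2 * pi})"
    if "x \<in> {a..r}" "y \<in> {0..2 * pi}" for x y
    by (rule C1_partials_D2[OF Y]) (use that x in \<open>auto simp: polar_rect_def\<close>)
  show "((\<lambda>s. Z (x, s)) has_vector_derivative Z\<^sub>2 (x, y)) (at y within {0..2 * pi})"
    if "x \<in> {a..r}" "y \<in> {0..2 * pi}" for x y
    by (rule C1_partials_D2[OF Z]) (use that x in \<open>auto simp: polar_rect_def\<close>)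
  have sub: "{a..r} \<times> {0..2 * pi} \<subseteq> polar_rect r" using x by (auto simp: polar_rect_def)
  show "continuous_on ({a..r} \<times> {0..2 * pi}) Z" "continuous_on ({a..r} \<times> {0..2 * pi}) Z\<^sub>2"
    using sub C1_partialsD(2-)[OF Z] continuous_on_subset by blast+
  show "at \<phi> within {0..2 * pi} \<noteq> bot"
    using x by (auto simp: trivial_limit_within intro!: islimpt_closure_open[where s="{0<..<2 * pi}"])
qed (use x in auto)

text \<open>The radii are geodesics. Indeed \<open>Z\<^sub>1 \<bullet> Z = 0\<close> because \<open>|Z| = 1\<close>, and differentiating
  \<open>Z \<bullet> V = 0\<close> in \<open>\<rho>\<close> gives \<open>Z\<^sub>1 \<bullet> V = - (Z \<bullet> Z\<^sub>2) = 0\<close>.\<close>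

lemma Z1_eq:
  assumes x: "\<rho> \<in> {0<..r}" "\<phi> \<in> {0..<2 * pi}"
  shows "Z\<^sub>1 (\<rho>, \<phi>) = l (\<rho>, \<phi>) *\<^sub>R n (\<rho>, \<phi>)"
proof -
  let ?x = "(\<rho>, \<phi>)"
  have S: "?x \<in> polar_rect r" using x by (auto simp: polar_rect_def)
  have dV: "((\<lambda>s. V (s, \<phi>)) has_vector_derivative Z\<^sub>2 ?x) (at \<rho> within {\<rho> / 2..r})"
    using V_derivative[of "\<rho> / 2" \<rho> \<phi>] x by auto
  have dZ: "((\<lambda>s. Z (s, \<phi>)) has_vector_derivative Z\<^sub>1 ?x) (at \<rho> within {\<rho> / 2..r})"
    by (rule C1_partials_D1[OF Z]) (use x in \<open>auto simp: polar_rect_def\<close>)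
  have "((\<lambda>s. Z (s, \<phi>) \<bullet> V (s, \<phi>)) has_vector_derivative Z ?x \<bullet> Z\<^sub>2 ?x + Z\<^sub>1 ?x \<bullet> V ?x) (at \<rho> within {\<rho> / 2..r})"
    by (rule bounded_bilinear.has_vector_derivative[OF bounded_bilinear_inner dZ dV])
  moreover have "((\<lambda>s. Z (s, \<phi>) \<bullet> V (s, \<phi>)) has_vector_derivative 0) (at \<rho> within {\<rho> / 2..r})"
    by (rule has_vector_derivative_transform[OF _ _ has_vector_derivative_const[of 0]])
       (use x ZV in \<open>auto simp: polar_rect_def\<close>)
  ultimately have "Z ?x \<bullet> Z\<^sub>2 ?x + Z\<^sub>1 ?x \<bullet> V ?x = 0"
    using vector_derivative_unique_within_closed_interval[of "\<rho> / 2" r \<rho>] x by fastforce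
  then have "Z\<^sub>1 ?x \<bullet> V ?x = 0"
    using partial_orthogonality(2)[OF S] by (simp add: inner_commute)
  then have "J ?x * (Z\<^sub>1 ?x \<bullet> cross3 (n ?x) (Z ?x)) = 0"
    using J_squared(2)[OF S] by (metis inner_scaleR_right)
  moreover have "J ?x \<noteq> 0" using J_squared(2)[OF S] V_nonzero[of \<rho> \<phi>] x by auto
  ultimately have "Z\<^sub>1 ?x \<bullet> cross3 (n ?x) (Z ?x) = 0" by simp
  then show ?thesis
    using orthonormal_expansion[OF nn[OF S] ZZ[OF S] nZ[OF S], of "Z\<^sub>1 ?x"]
      partial_orthogonality(1)[OF S] Z1n[OF S] by simp
qed

text \<open>Since \<open>Z\<^sub>1 = l n\<close> is \<open>C\<^sup>1\<close>, the mixed derivatives of \<open>Z\<close> may be interchanged.\<close>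

lemma Z2_derivative:
  assumes x: "0 < a" "\<rho> \<in> {a..r}" "\<phi> \<in> {0..<2 * pi}"
  shows "((\<lambda>s. Z\<^sub>2 (s, \<phi>)) has_vector_derivative
            l (\<rho>, \<phi>) *\<^sub>R n\<^sub>2 (\<rho>, \<phi>) + l\<^sub>2 (\<rho>, \<phi>) *\<^sub>R n (\<rho>, \<phi>)) (at \<rho> within {a..r})"
proof (rule mixed_partials[where f = Z and f\<^sub>1 = Z\<^sub>1 and U = "{0..<2 * pi}"
        and f\<^sub>1\<^sub>2 = "\<lambda>x. l x *\<^sub>R n\<^sub>2 x + l\<^sub>2 x *\<^sub>R n x"])
  note ln = C1_partials_bilinear[OF bounded_bilinear_scaleR l n]
  show "((\<lambda>s. Z (s, y)) has_vector_derivative Z\<^sub>1 (x, y)) (at x within {a..r})"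
    if "x \<in> {a..r}" "y \<in> {0..<2 * pi}" for x y
    by (rule C1_partials_D1[OF Z]) (use that x in \<open>auto simp: polar_rect_def\<close>)
  show "((\<lambda>s. Z (x, s)) has_vector_derivative Z\<^sub>2 (x, y)) (at y within {0..<2 * pi})"
    if "x \<in> {a..r}" "y \<in> {0..<2 * pi}" for x y
    by (rule C1_partials_D2[OF Z]) (use that x in \<open>auto simp: polar_rect_def\<close>)
  show "((\<lambda>s. Z\<^sub>1 (x', s)) has_vector_derivative l (x', y) *\<^sub>R n\<^sub>2 (x', y) + l\<^sub>2 (x', y) *\<^sub>R n (x', y))
          (at y within {0..<2 * pi})" if "x' \<in> {a..r}" "y \<in> {0..<2 * pi}" for x' y
  proof (rule has_vector_derivative_transform)
    show "((\<lambda>s. l (x', s) *\<^sub>R n (x', s)) has_vector_derivative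
            l (x', y) *\<^sub>R n\<^sub>2 (x', y) + l\<^sub>2 (x', y) *\<^sub>R n (x', y)) (at y within {0..<2 * pi})"
      by (rule C1_partials_D2[OF ln]) (use that x in \<open>auto simp: polar_rect_def\<close>)
    show "Z\<^sub>1 (x', s) = l (x', s) *\<^sub>R n (x', s)" if "s \<in> {0..<2 * pi}" for s
      using Z1_eq[of x' s] that \<open>x' \<in> {a..r}\<close> x by auto
  qed (use that in auto)
  have sub: "{a..r} \<times> {0..<2 * pi} \<subseteq> polar_rect r" using x by (auto simp: polar_rect_def)
  show "continuous_on ({a..r} \<times> {0..<2 * pi}) Z\<^sub>1"
    "continuous_on ({a..r} \<times> {0..<2 * pi}) (\<lambda>x. l x *\<^sub>R n\<^sub>2 x + l\<^sub>2 x *\<^sub>R n x)"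
    using sub C1_partialsD(2-)[OF Z] C1_partialsD(2-)[OF ln] continuous_on_subset by blast+
  show "at \<phi> within {0..<2 * pi} \<noteq> bot"
    using x by (auto simp: trivial_limit_within intro!: islimpt_closure_open[where s="{0<..<2 * pi}"])
qed (use x in auto)

text \<open>This is the product rule. The terms with \<open>n \<times> Z\<^sub>1\<close> vanish because \<open>Z\<^sub>1\<close> is a multiple of \<open>n\<close>,
  and \<open>V \<bullet> (n\<^sub>1 \<times> Z)\<close> vanishes because \<open>V\<close>, \<open>n\<^sub>1\<close> and \<open>Z\<close> are all tangent; the derivative
  \<open>l\<^sub>2\<close> contributes a multiple of \<open>n \<bullet> (n \<times> Z) = 0\<close> only.\<close>

lemma J_derivatives:
  assumes x: "\<rho> \<in> {0<..<r}" "\<phi> \<in> {0..<2 * pi}"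
  shows "((\<lambda>s. J (s, \<phi>)) has_real_derivative J\<^sub>1 (\<rho>, \<phi>)) (at \<rho>)"
    and "((\<lambda>s. J\<^sub>1 (s, \<phi>)) has_real_derivative J\<^sub>1\<^sub>1 (\<rho>, \<phi>)) (at \<rho>)"
proof -
  let ?x = "(\<rho>, \<phi>)" and ?I = "{\<rho> / 2..r}"
  have S: "?x \<in> polar_rect r" using x by (auto simp: polar_rect_def)
  have at: "at \<rho> within ?I = at \<rho>" using x by (intro at_within_interior) auto
  have dV: "((\<lambda>s. V (s, \<phi>)) has_vector_derivative Z\<^sub>2 ?x) (at \<rho>)"
    using V_derivative[of "\<rho> / 2" \<rho> \<phi>] x at by auto
  have dZ2: "((\<lambda>s. Z\<^sub>2 (s, \<phi>)) has_vector_derivative l ?x *\<^sub>R n\<^sub>2 ?x + l\<^sub>2 ?x *\<^sub>R n ?x) (at \<rho>)"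
    using Z2_derivative[of "\<rho> / 2" \<rho> \<phi>] x at by auto
  have Z1: "Z\<^sub>1 ?x = l ?x *\<^sub>R n ?x" using x by (intro Z1_eq) auto
  have dZ: "((\<lambda>s. Z (s, \<phi>)) has_vector_derivative Z\<^sub>1 ?x) (at \<rho> within ?I)"
    by (rule C1_partials_D1[OF Z]) (use x in \<open>auto simp: polar_rect_def\<close>)
  have dn: "((\<lambda>s. n (s, \<phi>)) has_vector_derivative n\<^sub>1 ?x) (at \<rho> within ?I)"
    by (rule C1_partials_D1[OF n]) (use x in \<open>auto simp: polar_rect_def\<close>)
  have "((\<lambda>s. cross3 (n (s, \<phi>)) (Z (s, \<phi>))) has_vector_derivative
      cross3 (n ?x) (Z\<^sub>1 ?x) + cross3 (n\<^sub>1 ?x) (Z ?x)) (at \<rho>)"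
    using bounded_bilinear.has_vector_derivative[OF bounded_bilinear_cross3 dn dZ] at by simp
  then have dT: "((\<lambda>s. cross3 (n (s, \<phi>)) (Z (s, \<phi>))) has_vector_derivative cross3 (n\<^sub>1 ?x) (Z ?x)) (at \<rho>)"
    by (simp add: Z1 cross_mult_right)
  have "V ?x \<bullet> cross3 (n\<^sub>1 ?x) (Z ?x) = 0"
  proof -
    have "cross3 (n ?x) (Z ?x) \<bullet> cross3 (n\<^sub>1 ?x) (Z ?x) = 0"
      using nZ[OF S] partial_orthogonality(3)[OF S] by (simp add: inner_cross_cross inner_commute)
    then show ?thesis by (subst J_squared(2)[OF S]) simp
  qed
  then show "((\<lambda>s. J (s, \<phi>)) has_real_derivative J\<^sub>1 ?x) (at \<rho>)"
    unfolding J_def J\<^sub>1_def has_real_derivative_iff_has_vector_derivative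
    using bounded_bilinear.has_vector_derivative[OF bounded_bilinear_inner dV dT] by simp
  have "n ?x \<bullet> cross3 (n ?x) (Z ?x) = 0" by (simp add: dot_cross_self)
  then show "((\<lambda>s. J\<^sub>1 (s, \<phi>)) has_real_derivative J\<^sub>1\<^sub>1 ?x) (at \<rho>)"
    unfolding J\<^sub>1_def J\<^sub>1\<^sub>1_def has_real_derivative_iff_has_vector_derivative
    using bounded_bilinear.has_vector_derivative[OF bounded_bilinear_inner dZ2 dT]
    by (simp add: inner_add_left algebra_simps)
qed

text \<open>On a surface of Gaussian curvature \<open>K\<close> one has \<open>n\<^sub>1 \<times> n\<^sub>2 = K Z \<times> V\<close>. The right-hand side
  is then \<open>- K J\<^sup>2\<close>, and the identity is the Jacobi equation \<open>J\<^sub>1\<^sub>1 = - K J\<close> multiplied by \<open>J\<close>.\<close>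

lemma jacobi_equation:
  assumes x: "x \<in> polar_rect r"
  shows "J\<^sub>1\<^sub>1 x * J x = - (cross3 (Z x) (V x) \<bullet> cross3 (n\<^sub>1 x) (n\<^sub>2 x))"
  unfolding J\<^sub>1\<^sub>1_def J_def
  by (rule jacobi_algebra)
     (use x nn ZZ nZ nV ZV partial_orthogonality Z1n in \<open>auto simp: inner_commute\<close>)

end

section \<open>Immersed discs and their unit normal\<close>

lemma disc_eq_cball: "disc = cball 0 1"
  by (auto simp: disc_def dist_norm norm_prod_def)

lemma C_k_on_dderiv: "C_k_on (Suc k) f S \<Longrightarrow> C_k_on k (dderiv S e f) S"
  by simp

lemma C_k_on_3_partials:
  assumes "C_k_on 3 X disc"
  shows "C1_partials X (D_u X) (D_v X) disc"
    and "C1_partials (D_u X) (D_u (D_u X)) (D_v (D_u X)) disc"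
    and "C1_partials (D_v X) (D_u (D_v X)) (D_v (D_v X)) disc"
    and "C1_partials (D_u (D_u X)) (D_u (D_u (D_u X))) (D_v (D_u (D_u X))) disc"
    and "C1_partials (D_v (D_u X)) (D_u (D_v (D_u X))) (D_v (D_v (D_u X))) disc"
    and "C1_partials (D_u (D_v X)) (D_u (D_u (D_v X))) (D_v (D_u (D_v X))) disc"
    and "C1_partials (D_v (D_v X)) (D_u (D_v (D_v X))) (D_v (D_v (D_v X))) disc"
proof -
  have 3: "C_k_on (Suc (Suc 1)) X disc" using assms by (simp add: numeral_3_eq_3)
  then have 2: "C_k_on (Suc 1) (D_u X) disc" "C_k_on (Suc 1) (D_v X) disc" "C_k_on 1 X disc"
    unfolding D_u_def D_v_def by (blast intro: C_k_on_dderiv C_k_on_Suc_imp)+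
  then have 1: "C_k_on 1 (D_u X) disc" "C_k_on 1 (D_v X) disc"
    "C_k_on 1 (D_u (D_u X)) disc" "C_k_on 1 (D_v (D_u X)) disc"
    "C_k_on 1 (D_u (D_v X)) disc" "C_k_on 1 (D_v (D_v X)) disc"
    unfolding D_u_def D_v_def by (blast intro: C_k_on_dderiv C_k_on_Suc_imp)+
  have *: "C1_partials f (D_u f) (D_v f) disc" if "C_k_on 1 f disc" for f
    unfolding D_u_def D_v_def by (rule C_k_on_1_imp_C1_partials[OF that])
  show "C1_partials X (D_u X) (D_v X) disc"
    and "C1_partials (D_u X) (D_u (D_u X)) (D_v (D_u X)) disc"
    and "C1_partials (D_v X) (D_u (D_v X)) (D_v (D_v X)) disc"
    and "C1_partials (D_u (D_u X)) (D_u (D_u (D_u X))) (D_v (D_u (D_u X))) disc"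
    and "C1_partials (D_v (D_u X)) (D_u (D_v (D_u X))) (D_v (D_v (D_u X))) disc"
    and "C1_partials (D_u (D_v X)) (D_u (D_u (D_v X))) (D_v (D_u (D_v X))) disc"
    and "C1_partials (D_v (D_v X)) (D_u (D_v (D_v X))) (D_v (D_v (D_v X))) disc"
    by - (rule *, fact)+
qed

lemma immersion_cross_nonzero:
  assumes X: "C1_partials X (D_u X) (D_v X) disc" and imm: "immersion_disc X" and w: "w \<in> disc"
  shows "cross3 (D_u X w) (D_v X w) \<noteq> 0"
proof
  assume 0: "cross3 (D_u X w) (D_v X w) = 0"
  let ?D = "frechet_derivative X (at w within disc)"
  have "(X has_derivative ?D) (at w within disc)"
    using C1_partialsD(1)[OF X w] by (auto simp: differentiable_def frechet_derivative_works[symmetric])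
  then interpret bounded_linear ?D by (rule has_derivative_bounded_linear)
  have D: "?D h = fst h *\<^sub>R D_u X w + snd h *\<^sub>R D_v X w" for h
  proof -
    have "h = fst h *\<^sub>R (1, 0) + snd h *\<^sub>R (0, 1)" by (cases h) auto
    then show ?thesis unfolding D_u_def D_v_def dderiv_def by (metis add scaleR)
  qed
  have "D_u X w = 0 \<or> D_v X w = 0 \<or> (\<exists>c. D_v X w = c *\<^sub>R D_u X w)"
    using 0 by (simp add: cross_eq_0 collinear_lemma)
  then obtain e where "range ?D \<subseteq> span {e}"
  proof (elim disjE exE)
    assume "D_u X w = 0"
    then show ?thesis by (intro that[of "D_v X w"]) (auto simp: D span_singleton)
  next
    assume "D_v X w = 0"
    then show ?thesis by (intro that[of "D_u X w"]) (auto simp: D span_singleton)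
  next
    fix c assume "D_v X w = c *\<^sub>R D_u X w"
    then show ?thesis
      by (intro that[of "D_u X w"]) (auto simp: D span_singleton scaleR_add_left[symmetric] simp del: scaleR_add_left)
  qed
  then have "dim (range ?D) \<le> card {e}" by (intro dim_le_card) auto
  then show False using imm w by (simp add: immersion_disc_def)
qed

text \<open>The normal is \<open>|W|\<^bsup>-1\<^esup> W\<close> for \<open>W = X\<^sub>u \<times> X\<^sub>v\<close>, and \<open>|W|\<^bsup>-1\<^esup>\<close> is a smooth function of
  \<open>W \<bullet> W > 0\<close>.\<close>

lemma unit_normal_C1:
  assumes X: "C_k_on 3 X disc" and imm: "immersion_disc X"
  obtains N\<^sub>1 N\<^sub>2 where "C1_partials (unit_normal X) N\<^sub>1 N\<^sub>2 disc"
proof -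
  note Xs = C_k_on_3_partials[OF X]
  define W where "W = (\<lambda>w. cross3 (D_u X w) (D_v X w))"
  obtain W\<^sub>1 W\<^sub>2 where W: "C1_partials W W\<^sub>1 W\<^sub>2 disc"
    unfolding W_def using C1_partials_bilinear[OF bounded_bilinear_cross3 Xs(2,3)] by blast
  obtain s\<^sub>1 s\<^sub>2 where s: "C1_partials (\<lambda>w. W w \<bullet> W w) s\<^sub>1 s\<^sub>2 disc"
    using C1_partials_bilinear[OF bounded_bilinear_inner W W] by blast
  have "W w \<noteq> 0" if "w \<in> disc" for w
    using immersion_cross_nonzero[OF Xs(1) imm that] by (simp add: W_def)
  then have im: "(\<lambda>w. W w \<bullet> W w) ` disc \<subseteq> {0<..}" by auto
  have d: "((\<lambda>y. inverse (sqrt y)) has_real_derivative - (inverse (sqrt y) * (inverse (sqrt y) / 2) * inverse (sqrt y))) (at y)"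
    if "y \<in> {0<..}" for y :: real
    using that by (auto intro!: derivative_eq_intros)
  have c: "continuous_on {0<..} (\<lambda>y::real. - (inverse (sqrt y) * (inverse (sqrt y) / 2) * inverse (sqrt y)))"
    by (auto intro!: continuous_intros)
  obtain i\<^sub>1 i\<^sub>2 where i: "C1_partials (\<lambda>w. inverse (sqrt (W w \<bullet> W w))) i\<^sub>1 i\<^sub>2 disc"
    using C1_partials_real_compose[OF d c s im] by blast
  obtain N\<^sub>1 N\<^sub>2 where "C1_partials (\<lambda>w. inverse (sqrt (W w \<bullet> W w)) *\<^sub>R W w) N\<^sub>1 N\<^sub>2 disc"
    using C1_partials_bilinear[OF bounded_bilinear_scaleR i W] by blast
  moreover have "(\<lambda>w. inverse (sqrt (W w \<bullet> W w)) *\<^sub>R W w) = unit_normal X"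
    by (simp add: unit_normal_def W_def norm_eq_sqrt_inner fun_eq_iff)
  ultimately show ?thesis using that by simp
qed

lemma unit_normal_inner:
  assumes "cross3 (D_u X w) (D_v X w) \<noteq> 0"
  shows "unit_normal X w \<bullet> unit_normal X w = 1"
    and "unit_normal X w \<bullet> D_u X w = 0" and "unit_normal X w \<bullet> D_v X w = 0"
    and "unit_normal X w \<bullet> cross3 (D_u X w) (D_v X w) = norm (cross3 (D_u X w) (D_v X w))"
  using assms by (auto simp: unit_normal_def dot_cross_self inner_commute power2_eq_square[symmetric]
      power2_norm_eq_inner[symmetric] field_simps)

lemma second_partials_symmetric:
  assumes X: "C_k_on 3 X disc" and w: "w \<in> interior disc"
  shows "D_v (D_u X) w = D_u (D_v X) w"
proof -
  note Xs = C_k_on_3_partials[OF X]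
  obtain u v where uv: "w = (u, v)" by fastforce
  obtain A B where AB: "open A" "open B" "u \<in> A" "v \<in> B" "A \<times> B \<subseteq> interior disc"
    using open_prod_elim[OF open_interior w] uv by (metis mem_Sigma_iff)
  obtain \<delta>\<^sub>1 where \<delta>\<^sub>1: "\<delta>\<^sub>1 > 0" "cball u \<delta>\<^sub>1 \<subseteq> A" using AB open_contains_cball by blast
  obtain \<delta>\<^sub>2 where \<delta>\<^sub>2: "\<delta>\<^sub>2 > 0" "cball v \<delta>\<^sub>2 \<subseteq> B" using AB open_contains_cball by blast
  let ?I = "{u - \<delta>\<^sub>1..u + \<delta>\<^sub>1}" and ?U = "{v - \<delta>\<^sub>2..v + \<delta>\<^sub>2}"
  have sub: "?I \<times> ?U \<subseteq> disc"
    using AB(5) \<delta>\<^sub>1(2) \<delta>\<^sub>2(2) interior_subset[of disc] unfolding cball_eq_atLeastAtMost by blast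
  have "((\<lambda>s. D_v X (s, v)) has_vector_derivative D_v (D_u X) (u, v)) (at u within ?I)"
  proof (rule mixed_partials[where f = X and f\<^sub>1 = "D_u X" and U = ?U])
    show "((\<lambda>s. X (s, y)) has_vector_derivative D_u X (x, y)) (at x within ?I)" if "x \<in> ?I" "y \<in> ?U" for x y
      by (rule C1_partials_D1[OF Xs(1)]) (use that sub in auto)
    show "((\<lambda>s. X (x, s)) has_vector_derivative D_v X (x, y)) (at y within ?U)" if "x \<in> ?I" "y \<in> ?U" for x y
      by (rule C1_partials_D2[OF Xs(1)]) (use that sub in auto)
    show "((\<lambda>s. D_u X (x, s)) has_vector_derivative D_v (D_u X) (x, y)) (at y within ?U)"
      if "x \<in> ?I" "y \<in> ?U" for x y
      by (rule C1_partials_D2[OF Xs(2)]) (use that sub in auto)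
    show "continuous_on (?I \<times> ?U) (D_u X)" "continuous_on (?I \<times> ?U) (D_v (D_u X))"
      using sub C1_partialsD(2-)[OF Xs(2)] continuous_on_subset by blast+
    show "at v within ?U \<noteq> bot"
      using \<delta>\<^sub>2 by (auto simp: trivial_limit_within intro!: islimpt_closure_open[where s="{v - \<delta>\<^sub>2<..<v + \<delta>\<^sub>2}"])
  qed (use \<delta>\<^sub>1 \<delta>\<^sub>2 in auto)
  moreover have "((\<lambda>s. D_v X (s, v)) has_vector_derivative D_u (D_v X) (u, v)) (at u within ?I)"
    by (rule C1_partials_D1[OF Xs(3)]) (use sub \<delta>\<^sub>1 \<delta>\<^sub>2 in auto)
  ultimately show ?thesis
    using vector_derivative_unique_within_closed_interval[of "u - \<delta>\<^sub>1" "u + \<delta>\<^sub>1" u] \<delta>\<^sub>1 uv by auto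
qed

text \<open>This is \<open>N\<^sub>u \<times> N\<^sub>v = K X\<^sub>u \<times> X\<^sub>v\<close> in scalar form. Differentiating
  \<open>X\<^sub>u \<bullet> N = X\<^sub>v \<bullet> N = 0\<close> turns the entries of \<open>(X\<^sub>u \<times> X\<^sub>v) \<bullet> (N\<^sub>u \<times> N\<^sub>v)\<close> into the coefficients of the
  second fundamental form. The restriction to interior points stems from the symmetry of
  second derivatives.\<close>

lemma weingarten_gauss:
  assumes X: "C_k_on 3 X disc" and imm: "immersion_disc X"
    and N: "C1_partials (unit_normal X) N\<^sub>1 N\<^sub>2 disc" and w: "w \<in> interior disc"
  shows "cross3 (D_u X w) (D_v X w) \<bullet> cross3 (N\<^sub>1 w) (N\<^sub>2 w)
           = gauss_curvature X w * (norm (cross3 (D_u X w) (D_v X w)))\<^sup>2"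
proof -
  note Xs = C_k_on_3_partials[OF X]
  have wd: "w \<in> disc" using w interior_subset by blast
  note nz = immersion_cross_nonzero[OF Xs(1) imm]
  have orth: "D_u X y \<bullet> unit_normal X y = 0" "D_v X y \<bullet> unit_normal X y = 0" if "y \<in> disc" for y
    using unit_normal_inner[OF nz[OF that]] by (simp_all add: inner_commute)
  note u = inner_const_partials[OF Xs(2) N wd axis_accessible_interior[OF w] orth(1)]
  note v = inner_const_partials[OF Xs(3) N wd axis_accessible_interior[OF w] orth(2)]
  have "(norm (cross3 (D_u X w) (D_v X w)))\<^sup>2 =
      (D_u X w \<bullet> D_u X w) * (D_v X w \<bullet> D_v X w) - (D_u X w \<bullet> D_v X w)\<^sup>2"
    unfolding power2_norm_eq_inner inner_cross_cross by (simp add: power2_eq_square inner_commute)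
  moreover have "(norm (cross3 (D_u X w) (D_v X w)))\<^sup>2 \<noteq> 0" using nz[OF wd] by simp
  moreover have "cross3 (D_u X w) (D_v X w) \<bullet> cross3 (N\<^sub>1 w) (N\<^sub>2 w) =
      (D_u (D_u X) w \<bullet> unit_normal X w) * (D_v (D_v X) w \<bullet> unit_normal X w)
        - (D_v (D_u X) w \<bullet> unit_normal X w)\<^sup>2"
  proof -
    have "D_u X w \<bullet> N\<^sub>1 w = - (D_u (D_u X) w \<bullet> unit_normal X w)" "D_v X w \<bullet> N\<^sub>2 w = - (D_v (D_v X) w \<bullet> unit_normal X w)"
      "D_u X w \<bullet> N\<^sub>2 w = - (D_v (D_u X) w \<bullet> unit_normal X w)" "D_v X w \<bullet> N\<^sub>1 w = - (D_v (D_u X) w \<bullet> unit_normal X w)"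
      using u v second_partials_symmetric[OF X w] by simp_all
    then show ?thesis by (simp add: inner_cross_cross power2_eq_square)
  qed
  ultimately show ?thesis
    by (simp add: gauss_curvature_def Let_def)
qed

section \<open>The boundary curve and geodesic polar coordinates\<close>

text \<open>For a boundary curve with velocity \<open>c'\<close> and acceleration \<open>c''\<close>, run through at angular speed \<open>t\<close>.
  The conormal \<open>Z\<close> is up to sign \<open>n \<times> c' / |c'|\<close>, so that \<open>\<kappa>\<^sub>g\<close> is \<open>Z \<bullet> c''\<close> divided by \<open>|c'|\<^sup>2\<close>; the
  hypothesis on \<open>Z\<^sub>2 \<bullet> c'\<close> is the derivative of \<open>Z \<bullet> c' = 0\<close>.\<close>

lemma geodesic_curvature_algebra:
  fixes n Z :: "real ^ 3"
  assumes on: "n \<bullet> n = 1" "Z \<bullet> Z = 1" "n \<bullet> Z = 0"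
    and c: "c' = k *\<^sub>R cross3 n Z" "k \<noteq> 0"
    and d: "Z\<^sub>2 \<bullet> c' = - (t * (Z \<bullet> c''))"
  shows "\<bar>Z\<^sub>2 \<bullet> cross3 n Z\<bar> = \<bar>c'' \<bullet> cross3 n c' / norm c' ^ 3\<bar> * norm c' * \<bar>t\<bar>"
proof -
  have "norm (cross3 n Z) = 1"
    using norm_cross_dot[of n Z] on by (simp add: norm_eq_sqrt_inner)
  then have k: "norm c' = \<bar>k\<bar>" using c by simp
  have "cross3 n (cross3 n Z) = - Z" using on by (simp add: Lagrange)
  then have "cross3 n c' = - (k *\<^sub>R Z)" using c by (simp add: cross_mult_right)
  moreover define m where "m = \<bar>k\<bar>"
  ultimately have 1: "\<bar>c'' \<bullet> cross3 n c' / norm c' ^ 3\<bar> = m * \<bar>Z \<bullet> c''\<bar> / m ^ 3"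
    by (simp add: k abs_mult inner_commute)
  have "m > 0" using c(2) by (simp add: m_def)
  moreover have "m * \<bar>Z\<^sub>2 \<bullet> cross3 n Z\<bar> = \<bar>t\<bar> * \<bar>Z \<bullet> c''\<bar>"
    using arg_cong[OF d, of abs] c by (simp add: abs_mult m_def)
  ultimately show ?thesis
    unfolding 1 by (simp add: k m_def[symmetric] field_simps power3_eq_cube)
qed

lemma C2_regular_curve_derivatives:
  assumes "C2_regular_curve c"
  defines "c' \<equiv> \<lambda>t. vector_derivative c (at t)"
  defines "c'' \<equiv> \<lambda>t. vector_derivative c' (at t)"
  shows "(c has_vector_derivative c' t) (at t)" "(c' has_vector_derivative c'' t) (at t)"
    and "continuous_on UNIV c'" "continuous_on UNIV c''" and "c' t \<noteq> 0"
proof -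
  have 2: "C_k_on (Suc 1) c UNIV" and nz: "\<And>t. c' t \<noteq> 0"
    using assms by (auto simp: C2_regular_curve_def numeral_2_eq_2)
  have fd: "dderiv UNIV 1 f = (\<lambda>t. vector_derivative f (at t))" if "f differentiable_on UNIV"
    for f :: "real \<Rightarrow> real ^ 3"
  proof
    fix t
    have "(f has_vector_derivative vector_derivative f (at t)) (at t)"
      using that by (simp add: differentiable_on_def vector_derivative_works[symmetric])
    then show "dderiv UNIV 1 f t = vector_derivative f (at t)"
      unfolding dderiv_def has_vector_derivative_def
      by (simp add: frechet_derivative_at[symmetric])
  qed
  have c: "c differentiable_on UNIV" using 2 by simp
  have c': "C_k_on 1 c' UNIV"
    using C_k_on_dderiv[OF 2, of 1] fd[OF c] by (simp add: c'_def del: One_nat_def)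
  then have d': "c' differentiable_on UNIV" by simp
  show "continuous_on UNIV c''"
    using c' fd[OF d'] unfolding One_nat_def C_k_on.simps c''_def by metis
  show "continuous_on UNIV c'" using d' by (rule differentiable_imp_continuous_on)
  show "(c has_vector_derivative c' t) (at t)"
    using c by (simp add: c'_def differentiable_on_def vector_derivative_works[symmetric])
  show "(c' has_vector_derivative c'' t) (at t)"
    using d' by (simp add: c''_def differentiable_on_def vector_derivative_works[symmetric])
  show "c' t \<noteq> 0" by (rule nz)
qed

lemma periodic_vector_derivative:
  fixes c :: "real \<Rightarrow> 'b::real_normed_vector"
  assumes d: "\<And>t. (c has_vector_derivative c' t) (at t)" and per: "\<And>t. c (t + p) = c t"
  shows "c' (t + p) = c' t"
proof -
  have "((\<lambda>s. s + p) has_vector_derivative 1) (at t)"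
    by (auto intro!: derivative_eq_intros)
  from vector_diff_chain_at[OF this d] have "((\<lambda>s. c (s + p)) has_vector_derivative c' (t + p)) (at t)"
    by (simp add: o_def)
  then have "(c has_vector_derivative c' (t + p)) (at t)" by (simp add: per)
  then show ?thesis using d[of t] vector_derivative_unique_at by blast
qed

lemma boundary_curvature_density:
  assumes N: "continuous_on disc (unit_normal X)" and c: "C2_regular_curve (boundary_curve X)"
  defines "g \<equiv> \<lambda>t. boundary_curvature X t * norm (boundary_velocity X t)"
  shows "continuous_on UNIV g" and "g (t + 2 * pi) = g t" and "g t \<ge> 0"
    and "\<bar>geodesic_curvature X t\<bar> * norm (boundary_velocity X t) \<le> g t"
proof -
  have v: "boundary_velocity X = (\<lambda>t. vector_derivative (boundary_curve X) (at t))"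
    and a: "boundary_accel X = (\<lambda>t. vector_derivative (boundary_velocity X) (at t))"
    by (auto simp: boundary_velocity_def boundary_accel_def)
  note C = C2_regular_curve_derivatives[OF c, folded boundary_velocity_def, folded v, folded boundary_accel_def, folded a]
  have cN: "continuous_on UNIV (\<lambda>t. unit_normal X (cos t, sin t))"
    by (rule continuous_on_compose2[OF N]) (auto simp: disc_def intro!: continuous_intros)
  show "continuous_on UNIV g"
    unfolding g_def boundary_curvature_def geodesic_curvature_def normal_curvature_def
    using C(5) by (intro continuous_intros continuous_on_cross cN C(3,4)) auto
  have pv: "boundary_velocity X (t + 2 * pi) = boundary_velocity X t" for t
    by (rule periodic_vector_derivative[OF C(1)]) (simp add: boundary_curve_def)
  have pa: "boundary_accel X (t + 2 * pi) = boundary_accel X t" for t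
    by (rule periodic_vector_derivative[OF C(2)]) (rule pv)
  show "g (t + 2 * pi) = g t"
    by (simp add: g_def boundary_curvature_def geodesic_curvature_def normal_curvature_def pv pa)
  show "g t \<ge> 0" by (simp add: g_def boundary_curvature_def)
  show "\<bar>geodesic_curvature X t\<bar> * norm (boundary_velocity X t) \<le> g t"
    unfolding g_def boundary_curvature_def
    by (intro mult_right_mono real_le_rsqrt) auto
qed

lemma geodesic_polar_coordinatesD:
  assumes "geodesic_polar_coordinates X w\<^sub>0 r \<Phi> P"
  shows "C_k_on 1 \<Phi> (polar_rect r)" and "C_k_on 1 (dderiv (polar_rect r) (1, 0) \<Phi>) (polar_rect r)"
    and "\<forall>\<rho>\<in>{0..r}. \<Phi> (\<rho>, 0) = \<Phi> (\<rho>, 2 * pi)"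
    and "bij_betw \<Phi> ({0<..r} \<times> {0..<2 * pi}) (disc - {w\<^sub>0})"
    and "(\<lambda>\<phi>. \<Phi> (r, \<phi>)) ` {0..2 * pi} = circle"
    and "\<forall>(\<rho>, \<phi>)\<in>polar_rect r.
           dderiv (polar_rect r) (1, 0) (X \<circ> \<Phi>) (\<rho>, \<phi>) \<bullet> dderiv (polar_rect r) (1, 0) (X \<circ> \<Phi>) (\<rho>, \<phi>) = 1 \<and>
           dderiv (polar_rect r) (1, 0) (X \<circ> \<Phi>) (\<rho>, \<phi>) \<bullet> dderiv (polar_rect r) (0, 1) (X \<circ> \<Phi>) (\<rho>, \<phi>) = 0 \<and>
           dderiv (polar_rect r) (0, 1) (X \<circ> \<Phi>) (\<rho>, \<phi>) \<bullet> dderiv (polar_rect r) (0, 1) (X \<circ> \<Phi>) (\<rho>, \<phi>) = P (\<rho>, \<phi>)"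
    and "\<forall>\<rho>\<in>{0<..r}. \<forall>\<phi>\<in>{0..<2 * pi}. P (\<rho>, \<phi>) > 0"
    and "\<forall>\<phi>\<in>{0..2 * pi}. ((\<lambda>\<rho>. P (\<rho>, \<phi>)) \<longlongrightarrow> 0) (at_right 0)"
proof -
  have rect: "{(\<rho>, \<phi>). 0 < \<rho> \<and> \<rho> \<le> r \<and> 0 \<le> \<phi> \<and> \<phi> < 2 * pi} = {0<..r} \<times> {0..<2 * pi}" by auto
  note pc = assms[unfolded geodesic_polar_coordinates_def Let_def rect]
  show "C_k_on 1 \<Phi> (polar_rect r)" and "C_k_on 1 (dderiv (polar_rect r) (1, 0) \<Phi>) (polar_rect r)"
    and "\<forall>\<rho>\<in>{0..r}. \<Phi> (\<rho>, 0) = \<Phi> (\<rho>, 2 * pi)"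
    and "bij_betw \<Phi> ({0<..r} \<times> {0..<2 * pi}) (disc - {w\<^sub>0})"
    and "(\<lambda>\<phi>. \<Phi> (r, \<phi>)) ` {0..2 * pi} = circle"
    and "\<forall>(\<rho>, \<phi>)\<in>polar_rect r.
           dderiv (polar_rect r) (1, 0) (X \<circ> \<Phi>) (\<rho>, \<phi>) \<bullet> dderiv (polar_rect r) (1, 0) (X \<circ> \<Phi>) (\<rho>, \<phi>) = 1 \<and>
           dderiv (polar_rect r) (1, 0) (X \<circ> \<Phi>) (\<rho>, \<phi>) \<bullet> dderiv (polar_rect r) (0, 1) (X \<circ> \<Phi>) (\<rho>, \<phi>) = 0 \<and>
           dderiv (polar_rect r) (0, 1) (X \<circ> \<Phi>) (\<rho>, \<phi>) \<bullet> dderiv (polar_rect r) (0, 1) (X \<circ> \<Phi>) (\<rho>, \<phi>) = P (\<rho>, \<phi>)"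
    and "\<forall>\<rho>\<in>{0<..r}. \<forall>\<phi>\<in>{0..<2 * pi}. P (\<rho>, \<phi>) > 0"
    using pc by - (elim conjE, assumption)+
  have "\<forall>\<phi>\<in>{0..2 * pi}. ((\<lambda>\<rho>. P (\<rho>, \<phi>)) \<longlongrightarrow> 0) (at_right 0) \<and>
      ((\<lambda>\<rho>. deriv (\<lambda>s. sqrt (P (s, \<phi>))) \<rho>) \<longlongrightarrow> 1) (at_right 0)"
    using pc by (elim conjE)
  then show "\<forall>\<phi>\<in>{0..2 * pi}. ((\<lambda>\<rho>. P (\<rho>, \<phi>)) \<longlongrightarrow> 0) (at_right 0)" by blast
qed

text \<open>What the polar coordinates of an immersion provide. The point is the regularity of \<open>l\<close>:
  \<open>Z\<^sub>1\<close> contains the second radial derivative of \<open>\<Phi>\<close>, which is merely continuous, but only in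
  tangential terms. Its normal component is the second fundamental form evaluated on the \<open>C\<^sup>1\<close>
  vector \<open>a = \<Phi>\<^sub>\<rho>\<close>.\<close>

lemma geodesic_polar_frame:
  assumes X: "C_k_on 3 X disc" and imm: "immersion_disc X" and r: "r > 0"
    and pc: "geodesic_polar_coordinates X w\<^sub>0 r \<Phi> P"
  obtains a b Z V n Z\<^sub>1 Z\<^sub>2 n\<^sub>1 n\<^sub>2 l l\<^sub>1 l\<^sub>2
  where "C1_partials \<Phi> a b (polar_rect r)"
    and "geodesic_frame r (\<lambda>x. X (\<Phi> x)) Z V Z\<^sub>1 Z\<^sub>2 n n\<^sub>1 n\<^sub>2 l l\<^sub>1 l\<^sub>2"
    and "\<And>x. n x = unit_normal X (\<Phi> x)"
    and "\<And>x. x \<in> polar_rect r \<Longrightarrow> V x \<bullet> V x = P x"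
    and "\<And>x. x \<in> polar_rect r \<Longrightarrow> V x \<bullet> cross3 (n x) (Z x) =
            (fst (a x) * snd (b x) - snd (a x) * fst (b x)) * norm (cross3 (D_u X (\<Phi> x)) (D_v X (\<Phi> x)))"
    and "\<And>x. x \<in> polar_rect r \<Longrightarrow> \<Phi> x \<in> interior disc \<Longrightarrow>
            cross3 (Z x) (V x) \<bullet> cross3 (n\<^sub>1 x) (n\<^sub>2 x) =
              gauss_curvature X (\<Phi> x) * (V x \<bullet> cross3 (n x) (Z x))\<^sup>2"
proof -
  define S where "S = polar_rect r"
  define a b where "a = dderiv S (1, 0) \<Phi>" and "b = dderiv S (0, 1) \<Phi>"
  define Z V n where "Z = (\<lambda>x. fst (a x) *\<^sub>R D_u X (\<Phi> x) + snd (a x) *\<^sub>R D_v X (\<Phi> x))"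
    and "V = (\<lambda>x. fst (b x) *\<^sub>R D_u X (\<Phi> x) + snd (b x) *\<^sub>R D_v X (\<Phi> x))"
    and "n = (\<lambda>x. unit_normal X (\<Phi> x))"
  note Xs = C_k_on_3_partials[OF X]
  note nz = immersion_cross_nonzero[OF Xs(1) imm]
  note pc' = geodesic_polar_coordinatesD[OF pc, folded S_def]
  have \<Phi>: "C1_partials \<Phi> a b S"
    unfolding a_def b_def by (rule C_k_on_1_imp_C1_partials[OF pc'(1)])
  define a\<^sub>1 a\<^sub>2 where "a\<^sub>1 = dderiv S (1, 0) a" and "a\<^sub>2 = dderiv S (0, 1) a"
  have a: "C1_partials a a\<^sub>1 a\<^sub>2 S"
    unfolding a\<^sub>1_def a\<^sub>2_def a_def by (rule C_k_on_1_imp_C1_partials[OF pc'(2)])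
  have sub: "\<Phi> ` S \<subseteq> disc"
  proof (intro image_subsetI)
    fix x assume "x \<in> S"
    then obtain \<rho> \<phi> where x: "x = (\<rho>, \<phi>)" "0 < \<rho>" "\<rho> \<le> r" "0 \<le> \<phi>" "\<phi> \<le> 2 * pi"
      by (auto simp: S_def polar_rect_def)
    have im: "\<Phi> ` ({0<..r} \<times> {0..<2 * pi}) = disc - {w\<^sub>0}"
      using pc'(4) by (simp add: bij_betw_def)
    show "\<Phi> x \<in> disc"
    proof (cases "\<phi> = 2 * pi")
      case True
      then have "\<Phi> x = \<Phi> (\<rho>, 0)" using pc'(3) x by auto
      moreover have "\<Phi> (\<rho>, 0) \<in> \<Phi> ` ({0<..r} \<times> {0..<2 * pi})" using x by (intro imageI) auto
      ultimately show ?thesis using im by simp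
    next
      case False
      then have "\<Phi> x \<in> \<Phi> ` ({0<..r} \<times> {0..<2 * pi})" using x by (intro imageI) auto
      then show ?thesis using im by simp
    qed
  qed
  have acc: "axis_accessible x S" if "x \<in> S" for x
    using that by (simp add: S_def axis_accessible_polar_rect)
  have Y: "C1_partials (\<lambda>x. X (\<Phi> x)) Z V S"
    unfolding Z_def V_def by (rule C1_partials_compose[OF Xs(1) \<Phi> sub])
  have ZV_eq: "dderiv S (1, 0) (X \<circ> \<Phi>) x = Z x" "dderiv S (0, 1) (X \<circ> \<Phi>) x = V x" if "x \<in> S" for x
    using C1_partials_dderiv[OF Y that acc[OF that]] by (simp_all add: o_def)
  have metric: "Z x \<bullet> Z x = 1 \<and> Z x \<bullet> V x = 0 \<and> V x \<bullet> V x = P x" if "x \<in> S" for x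
    using pc'(6) that ZV_eq[OF that] by (cases x) auto
  obtain N\<^sub>1 N\<^sub>2 where N: "C1_partials (unit_normal X) N\<^sub>1 N\<^sub>2 disc"
    using unit_normal_C1[OF X imm] .
  define n\<^sub>1 n\<^sub>2 where "n\<^sub>1 = (\<lambda>x. fst (a x) *\<^sub>R N\<^sub>1 (\<Phi> x) + snd (a x) *\<^sub>R N\<^sub>2 (\<Phi> x))"
    and "n\<^sub>2 = (\<lambda>x. fst (b x) *\<^sub>R N\<^sub>1 (\<Phi> x) + snd (b x) *\<^sub>R N\<^sub>2 (\<Phi> x))"
  have n: "C1_partials n n\<^sub>1 n\<^sub>2 S"
    unfolding n_def n\<^sub>1_def n\<^sub>2_def by (rule C1_partials_compose[OF N \<Phi> sub])
  have normal: "n x \<bullet> n x = 1" "n x \<bullet> D_u X (\<Phi> x) = 0" "n x \<bullet> D_v X (\<Phi> x) = 0"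
    "n x \<bullet> cross3 (D_u X (\<Phi> x)) (D_v X (\<Phi> x)) = norm (cross3 (D_u X (\<Phi> x)) (D_v X (\<Phi> x)))" if "x \<in> S" for x
    using unit_normal_inner[OF nz[of "\<Phi> x"]] sub that by (auto simp: n_def)
  note fa = C1_partials_linear[OF bounded_linear_fst a] and sa = C1_partials_linear[OF bounded_linear_snd a]
  note p = C1_partials_compose[OF Xs(2) \<Phi> sub] and q = C1_partials_compose[OF Xs(3) \<Phi> sub]
  obtain Z\<^sub>1 Z\<^sub>2 where Z: "C1_partials Z Z\<^sub>1 Z\<^sub>2 S"
    and Z1: "Z\<^sub>1 = (\<lambda>x. (fst (a x) *\<^sub>R (fst (a x) *\<^sub>R D_u (D_u X) (\<Phi> x) + snd (a x) *\<^sub>R D_v (D_u X) (\<Phi> x))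
                 + fst (a\<^sub>1 x) *\<^sub>R D_u X (\<Phi> x))
               + (snd (a x) *\<^sub>R (fst (a x) *\<^sub>R D_u (D_v X) (\<Phi> x) + snd (a x) *\<^sub>R D_v (D_v X) (\<Phi> x))
                 + snd (a\<^sub>1 x) *\<^sub>R D_v X (\<Phi> x)))"
    using C1_partials_add[OF C1_partials_bilinear[OF bounded_bilinear_scaleR fa p]
        C1_partials_bilinear[OF bounded_bilinear_scaleR sa q]] unfolding Z_def by blast
  define l where "l = (\<lambda>x. fst (a x) * (fst (a x) * (D_u (D_u X) (\<Phi> x) \<bullet> n x) + snd (a x) * (D_v (D_u X) (\<Phi> x) \<bullet> n x))
      + snd (a x) * (fst (a x) * (D_u (D_v X) (\<Phi> x) \<bullet> n x) + snd (a x) * (D_v (D_v X) (\<Phi> x) \<bullet> n x)))"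
  have h: "\<exists>f\<^sub>1 f\<^sub>2. C1_partials (\<lambda>x. f (\<Phi> x) \<bullet> n x) f\<^sub>1 f\<^sub>2 S" if "C1_partials f g\<^sub>1 g\<^sub>2 disc" for f g\<^sub>1 g\<^sub>2
    using C1_partials_bilinear[OF bounded_bilinear_inner C1_partials_compose[OF that \<Phi> sub] n] by blast
  have mult: "\<exists>h\<^sub>1 h\<^sub>2. C1_partials (\<lambda>x. f x * g x) h\<^sub>1 h\<^sub>2 S"
    if "\<exists>f\<^sub>1 f\<^sub>2. C1_partials f f\<^sub>1 f\<^sub>2 S" "\<exists>g\<^sub>1 g\<^sub>2. C1_partials g g\<^sub>1 g\<^sub>2 S" for f g :: "real \<times> real \<Rightarrow> real"
    using that C1_partials_bilinear[OF bounded_bilinear_mult] by blast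
  have add: "\<exists>h\<^sub>1 h\<^sub>2. C1_partials (\<lambda>x. f x + g x) h\<^sub>1 h\<^sub>2 S"
    if "\<exists>f\<^sub>1 f\<^sub>2. C1_partials f f\<^sub>1 f\<^sub>2 S" "\<exists>g\<^sub>1 g\<^sub>2. C1_partials g g\<^sub>1 g\<^sub>2 S" for f g :: "real \<times> real \<Rightarrow> real"
    using that C1_partials_add by blast
  have fa': "\<exists>f\<^sub>1 f\<^sub>2. C1_partials (\<lambda>x. fst (a x)) f\<^sub>1 f\<^sub>2 S" and sa': "\<exists>f\<^sub>1 f\<^sub>2. C1_partials (\<lambda>x. snd (a x)) f\<^sub>1 f\<^sub>2 S"
    using fa sa by blast+
  have "\<exists>l\<^sub>1 l\<^sub>2. C1_partials l l\<^sub>1 l\<^sub>2 S"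
    unfolding l_def
    by (intro add mult fa' sa' h[OF Xs(4)] h[OF Xs(5)] h[OF Xs(6)] h[OF Xs(7)])
  then obtain l\<^sub>1 l\<^sub>2 where l: "C1_partials l l\<^sub>1 l\<^sub>2 S" by blast
  have frame: "geodesic_frame r (\<lambda>x. X (\<Phi> x)) Z V Z\<^sub>1 Z\<^sub>2 n n\<^sub>1 n\<^sub>2 l l\<^sub>1 l\<^sub>2"
  proof (unfold_locales, fold S_def)
    show "n x \<bullet> Z x = 0" "n x \<bullet> V x = 0" if "x \<in> S" for x
      using normal[OF that] by (simp_all add: Z_def V_def inner_add_right)
    show "Z\<^sub>1 x \<bullet> n x = l x" if "x \<in> S" for x
      using normal[OF that] by (simp add: Z1 l_def inner_add_left inner_add_right inner_commute)
    show "V (\<rho>, \<phi>) \<noteq> 0" if "0 < \<rho>" "\<rho> \<le> r" "0 \<le> \<phi>" "\<phi> < 2 * pi" for \<rho> \<phi>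
    proof -
      have "P (\<rho>, \<phi>) > 0" using pc'(7) that by auto
      moreover have "(\<rho>, \<phi>) \<in> S" using that by (auto simp: S_def polar_rect_def)
      ultimately show ?thesis using metric by fastforce
    qed
  qed (use r Y Z n l metric normal in auto)
  have cross: "cross3 (Z x) (V x) =
      (fst (a x) * snd (b x) - snd (a x) * fst (b x)) *\<^sub>R cross3 (D_u X (\<Phi> x)) (D_v X (\<Phi> x))"
    "cross3 (n\<^sub>1 x) (n\<^sub>2 x) = (fst (a x) * snd (b x) - snd (a x) * fst (b x)) *\<^sub>R cross3 (N\<^sub>1 (\<Phi> x)) (N\<^sub>2 (\<Phi> x))" for x
    by (simp_all add: Z_def V_def n\<^sub>1_def n\<^sub>2_def cross_add_left cross_add_right cross_mult_left cross_mult_right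
        cross_skew[of "D_v X (\<Phi> x)" "D_u X (\<Phi> x)"] cross_skew[of "N\<^sub>2 (\<Phi> x)" "N\<^sub>1 (\<Phi> x)"] algebra_simps)
  have J: "V x \<bullet> cross3 (n x) (Z x) =
      (fst (a x) * snd (b x) - snd (a x) * fst (b x)) * norm (cross3 (D_u X (\<Phi> x)) (D_v X (\<Phi> x)))" if "x \<in> S" for x
  proof -
    have "V x \<bullet> cross3 (n x) (Z x) = n x \<bullet> cross3 (Z x) (V x)"
      using cross_triple[of "n x" "Z x" "V x"] by (simp add: inner_commute)
    then show ?thesis using normal(4)[OF that] by (simp add: cross)
  qed
  show thesis
  proof (rule that[OF \<Phi>[unfolded S_def] frame], fold S_def)
    fix x assume x: "x \<in> S" "\<Phi> x \<in> interior disc"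
    show "cross3 (Z x) (V x) \<bullet> cross3 (n\<^sub>1 x) (n\<^sub>2 x) =
              gauss_curvature X (\<Phi> x) * (V x \<bullet> cross3 (n x) (Z x))\<^sup>2"
      unfolding J[OF x(1)] cross using weingarten_gauss[OF X imm N x(2)]
      by (simp add: power2_eq_square)
  qed (use metric J in \<open>auto simp: n_def\<close>)
qed

section \<open>The area of a geodesic disc\<close>

lemma bounded_continuous_integrable:
  fixes f :: "'a::euclidean_space \<Rightarrow> real"
  assumes "continuous_on S f" "S \<in> sets lebesgue" "bounded S" "\<And>x. x \<in> S \<Longrightarrow> \<bar>f x\<bar> \<le> B"
  shows "f integrable_on S"
proof (rule measurable_bounded_by_integrable_imp_integrable_real)
  show "f \<in> borel_measurable (lebesgue_on S)"
    using assms by (intro continuous_imp_measurable_on_sets_lebesgue)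
  show "(\<lambda>_. B) integrable_on S"
    using assms by (intro integrable_on_const bounded_set_imp_lmeasurable)
qed (use assms in auto)

lemma integral_nonneg_always:
  fixes f :: "'a::euclidean_space \<Rightarrow> real"
  assumes "\<And>x. x \<in> S \<Longrightarrow> 0 \<le> f x"
  shows "0 \<le> integral S f"
  using assms by (cases "f integrable_on S") (auto intro: integral_nonneg simp: not_integrable_integral)

lemma surface_area_nonneg: "surface_area X \<ge> 0"
  unfolding surface_area_def by (rule integral_nonneg_always) auto

text \<open>Only the points with \<open>\<rho> = r\<close> lie on the unit circle, by injectivity of \<open>\<Phi>\<close>; this is what keeps
  the open radii in the interior of the disc, where the Gauss equation is available.\<close>

lemma polar_disc_images:
  assumes pc: "geodesic_polar_coordinates X w\<^sub>0 r \<Phi> P" and r: "r > 0"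
  shows "\<Phi> ` ({0<..r} \<times> {0..<2 * pi}) = disc - {w\<^sub>0}"
    and "\<And>\<phi>. \<phi> \<in> {0..2 * pi} \<Longrightarrow> \<Phi> (r, \<phi>) \<in> circle"
    and "inj_on (\<lambda>\<phi>. \<Phi> (r, \<phi>)) {0..<2 * pi}"
    and "\<And>\<rho> \<phi>. \<rho> \<in> {0<..<r} \<Longrightarrow> \<phi> \<in> {0..<2 * pi} \<Longrightarrow> \<Phi> (\<rho>, \<phi>) \<in> interior disc"
proof -
  note pc' = geodesic_polar_coordinatesD[OF pc]
  note bij = pc'(4) and circ = pc'(5)
  show im: "\<Phi> ` ({0<..r} \<times> {0..<2 * pi}) = disc - {w\<^sub>0}" using bij by (simp add: bij_betw_def)
  have inj: "inj_on \<Phi> ({0<..r} \<times> {0..<2 * pi})" using bij by (simp add: bij_betw_def)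
  show "\<Phi> (r, \<phi>) \<in> circle" if "\<phi> \<in> {0..2 * pi}" for \<phi>
    unfolding circ[symmetric] using that by (rule imageI)
  show "inj_on (\<lambda>\<phi>. \<Phi> (r, \<phi>)) {0..<2 * pi}"
  proof (rule inj_onI)
    fix s t assume "s \<in> {0..<2 * pi}" "t \<in> {0..<2 * pi}" "\<Phi> (r, s) = \<Phi> (r, t)"
    then have "(r, s) = (r, t)"
      by - (rule inj_onD[OF inj], use r in auto)
    then show "s = t" by simp
  qed
  fix \<rho> \<phi> :: real assume x: "\<rho> \<in> {0<..<r}" "\<phi> \<in> {0..<2 * pi}"
  then have "\<Phi> (\<rho>, \<phi>) \<in> \<Phi> ` ({0<..r} \<times> {0..<2 * pi})" by (intro imageI) auto
  then have d: "\<Phi> (\<rho>, \<phi>) \<in> disc" using im by simp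
  have "\<Phi> (\<rho>, \<phi>) \<notin> circle"
  proof
    assume "\<Phi> (\<rho>, \<phi>) \<in> circle"
    then obtain \<psi> where \<psi>: "\<psi> \<in> {0..2 * pi}" "\<Phi> (\<rho>, \<phi>) = \<Phi> (r, \<psi>)"
      unfolding circ[symmetric] by (elim imageE)
    moreover have "\<Phi> (r, 0) = \<Phi> (r, 2 * pi)" using pc'(3) r by auto
    ultimately obtain \<psi>' where "\<psi>' \<in> {0..<2 * pi}" "\<Phi> (\<rho>, \<phi>) = \<Phi> (r, \<psi>')"
      by (cases "\<psi> = 2 * pi") (auto intro: that[of 0] that[of \<psi>])
    then have "(\<rho>, \<phi>) = (r, \<psi>')"
      by - (rule inj_onD[OF inj], use x r in auto)
    then show False using x by simp
  qed
  with d have "\<Phi> (\<rho>, \<phi>) \<in> ball 0 1"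
    by (cases "\<Phi> (\<rho>, \<phi>)") (auto simp: disc_def circle_def dist_norm norm_prod_def)
  then show "\<Phi> (\<rho>, \<phi>) \<in> interior disc"
    by (simp add: disc_eq_cball)
qed

context geodesic_frame
begin

text \<open>Along a radius \<open>J\<close> has no zeros, hence a constant sign \<open>\<sigma>\<close>, and the comparison lemma applies
  to \<open>\<sigma> J = |J|\<close>.\<close>

lemma J_bound:
  assumes \<phi>: "\<phi> \<in> {0..<2 * pi}" and \<rho>: "\<rho> \<in> {0<..r}"
    and K: "K \<ge> 0" and small: "K / 2 * r\<^sup>2 < 1"
    and curv: "\<And>\<rho>. \<rho> \<in> {0<..<r} \<Longrightarrow>
       cross3 (Z (\<rho>, \<phi>)) (V (\<rho>, \<phi>)) \<bullet> cross3 (n\<^sub>1 (\<rho>, \<phi>)) (n\<^sub>2 (\<rho>, \<phi>)) \<le> K * (J (\<rho>, \<phi>))\<^sup>2"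
    and lim: "((\<lambda>\<rho>. J (\<rho>, \<phi>)) \<longlongrightarrow> 0) (at_right 0)"
  shows "\<bar>J (\<rho>, \<phi>)\<bar> * (1 - K / 2 * r\<^sup>2) \<le> \<rho> * \<bar>J\<^sub>1 (r, \<phi>)\<bar>"
proof -
  have S: "(s, \<phi>) \<in> polar_rect r" if "s \<in> {0<..r}" for s
    using that \<phi> by (auto simp: polar_rect_def)
  have cont: "continuous_on {0<..r} (\<lambda>s. f (s, \<phi>))" if "continuous_on (polar_rect r) f"
    for f :: "real \<times> real \<Rightarrow> real"
    by (rule continuous_on_compose2[OF that]) (use S in \<open>auto intro!: continuous_intros\<close>)
  have nz: "J (s, \<phi>) \<noteq> 0" if "s \<in> {0<..r}" for s
    using J_squared(2)[OF S[OF that]] V_nonzero[of s \<phi>] that \<phi> by auto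
  define \<sigma> where "\<sigma> = sgn (J (r, \<phi>))"
  have \<sigma>: "\<sigma> * \<sigma> = 1" "\<bar>\<sigma>\<bar> = 1" using nz[of r] r by (auto simp: \<sigma>_def sgn_if)
  have pos: "0 < \<sigma> * J (s, \<phi>)" if s: "s \<in> {0<..r}" for s
  proof (rule ccontr)
    assume "\<not> ?thesis"
    moreover have "0 \<le> \<sigma> * J (r, \<phi>)" by (auto simp: \<sigma>_def sgn_if)
    moreover have "continuous_on {s..r} (\<lambda>s. \<sigma> * J (s, \<phi>))"
      using s by (intro continuous_intros continuous_on_subset[OF cont[OF continuous_J(1)]]) auto
    ultimately obtain t where "s \<le> t" "t \<le> r" "\<sigma> * J (t, \<phi>) = 0"
      using IVT'[of "\<lambda>s. \<sigma> * J (s, \<phi>)" s 0 r] s by auto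
    then show False using nz[of t] \<sigma> s by auto
  qed
  have "\<sigma> * J (\<rho>, \<phi>) * (1 - K / 2 * r\<^sup>2) \<le> \<rho> * (\<sigma> * J\<^sub>1 (r, \<phi>))"
  proof (rule concavity_defect_bound[OF r K small])
    show "((\<lambda>s. \<sigma> * J (s, \<phi>)) \<longlongrightarrow> 0) (at_right 0)"
      using tendsto_mult_left[OF lim, of \<sigma>] by simp
    show "continuous_on {0<..r} (\<lambda>s. \<sigma> * J (s, \<phi>))" "continuous_on {0<..r} (\<lambda>s. \<sigma> * J\<^sub>1 (s, \<phi>))"
      by (intro continuous_intros cont continuous_J)+
    fix s assume s: "s \<in> {0<..<r}"
    show "((\<lambda>s. \<sigma> * J (s, \<phi>)) has_real_derivative \<sigma> * J\<^sub>1 (s, \<phi>)) (at s)"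
      "((\<lambda>s. \<sigma> * J\<^sub>1 (s, \<phi>)) has_real_derivative \<sigma> * J\<^sub>1\<^sub>1 (s, \<phi>)) (at s)"
      using J_derivatives[OF s \<phi>] by (auto intro!: DERIV_cmult)
    \<comment> \<open>the Jacobi equation is available only after multiplication by \<open>J\<close>, which is then cancelled\<close>
    have "- (K * (J (s, \<phi>))\<^sup>2) \<le> J\<^sub>1\<^sub>1 (s, \<phi>) * J (s, \<phi>)"
      using jacobi_equation[OF S] curv[OF s] s by auto
    then have "(\<sigma> * \<sigma>) * - (K * (J (s, \<phi>))\<^sup>2) \<le> (\<sigma> * \<sigma>) * (J\<^sub>1\<^sub>1 (s, \<phi>) * J (s, \<phi>))"
      unfolding \<sigma>(1) by simp
    then have "- (K * (\<sigma> * J (s, \<phi>))) * (\<sigma> * J (s, \<phi>)) \<le> (\<sigma> * J\<^sub>1\<^sub>1 (s, \<phi>)) * (\<sigma> * J (s, \<phi>))"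
      by (simp add: power2_eq_square algebra_simps)
    then show "- (K * (\<sigma> * J (s, \<phi>))) \<le> \<sigma> * J\<^sub>1\<^sub>1 (s, \<phi>)"
      using pos[of s] s by (simp only: mult_le_cancel_right) auto
  qed (use pos \<rho> less_imp_le in auto)
  moreover have "\<sigma> * J (\<rho>, \<phi>) = \<bar>J (\<rho>, \<phi>)\<bar>"
    using pos[OF \<rho>] \<sigma>(2) by (metis abs_mult abs_of_pos mult_1)
  moreover have "\<sigma> * J\<^sub>1 (r, \<phi>) \<le> \<bar>J\<^sub>1 (r, \<phi>)\<bar>"
    using abs_ge_self[of "\<sigma> * J\<^sub>1 (r, \<phi>)"] \<sigma>(2) by (simp add: abs_mult)
  then have "\<rho> * (\<sigma> * J\<^sub>1 (r, \<phi>)) \<le> \<rho> * \<bar>J\<^sub>1 (r, \<phi>)\<bar>"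
    using \<rho> by (intro mult_left_mono) auto
  ultimately show ?thesis by simp
qed

text \<open>On the boundary \<open>V = \<theta>' c'\<close>, so \<open>Z\<close> is orthogonal to the velocity \<open>c'\<close> there. Differentiating
  \<open>Z \<bullet> c'(\<theta>) = 0\<close> in \<open>\<phi>\<close> expresses \<open>J\<^sub>1 = Z\<^sub>2 \<bullet> (n \<times> Z)\<close> by the acceleration, without a third
  derivative of \<open>X\<close> or a second angular derivative of \<open>\<Phi>\<close>.\<close>

lemma J1_boundary:
  assumes c: "C2_regular_curve (boundary_curve X)"
    and YX: "\<And>x. Y x = X (\<Phi> x)" and nX: "\<And>x. n x = unit_normal X (\<Phi> x)"
    and d\<theta>: "\<And>\<phi>. \<phi> \<in> {0..2 * pi} \<Longrightarrow> (\<theta> has_real_derivative \<theta>' \<phi>) (at \<phi> within {0..2 * pi})"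
    and \<Phi>\<theta>: "\<And>\<phi>. \<phi> \<in> {0..2 * pi} \<Longrightarrow> \<Phi> (r, \<phi>) = (cos (\<theta> \<phi>), sin (\<theta> \<phi>))"
    and \<phi>: "\<phi> \<in> {0..<2 * pi}"
  shows "\<theta>' \<phi> \<noteq> 0"
    and "\<bar>J\<^sub>1 (r, \<phi>)\<bar> = \<bar>geodesic_curvature X (\<theta> \<phi>)\<bar> * norm (boundary_velocity X (\<theta> \<phi>)) * \<bar>\<theta>' \<phi>\<bar>"
proof -
  have v: "boundary_velocity X = (\<lambda>t. vector_derivative (boundary_curve X) (at t))"
    and a: "boundary_accel X = (\<lambda>t. vector_derivative (boundary_velocity X) (at t))"
    by (auto simp: boundary_velocity_def boundary_accel_def)
  note C = C2_regular_curve_derivatives[OF c, folded boundary_velocity_def, folded v, folded boundary_accel_def, folded a]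
  let ?c' = "boundary_velocity X" and ?c'' = "boundary_accel X" and ?I = "{0..<2 * pi}"
  have S: "(r, \<psi>) \<in> polar_rect r" if "\<psi> \<in> {0..2 * pi}" for \<psi>
    using that r by (auto simp: polar_rect_def)
  have nontriv: "at \<psi> within ?I \<noteq> bot" if "\<psi> \<in> ?I" for \<psi>
    using that by (auto simp: trivial_limit_within intro!: islimpt_closure_open[where s="{0<..<2 * pi}"])
  have d\<theta>': "(\<theta> has_vector_derivative \<theta>' \<psi>) (at \<psi> within ?I)" if "\<psi> \<in> ?I" for \<psi>
    unfolding has_real_derivative_iff_has_vector_derivative[symmetric]
    by (rule has_field_derivative_subset[OF d\<theta>]) (use that in auto)
  have V\<theta>: "V (r, \<psi>) = \<theta>' \<psi> *\<^sub>R ?c' (\<theta> \<psi>)" if \<psi>: "\<psi> \<in> ?I" for \<psi>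
  proof -
    have "((\<lambda>s. boundary_curve X (\<theta> s)) has_vector_derivative \<theta>' \<psi> *\<^sub>R ?c' (\<theta> \<psi>)) (at \<psi> within ?I)"
      using vector_diff_chain_within[OF d\<theta>'[OF \<psi>] has_vector_derivative_at_within[OF C(1)]] by (simp add: o_def)
    then have "((\<lambda>s. Y (r, s)) has_vector_derivative \<theta>' \<psi> *\<^sub>R ?c' (\<theta> \<psi>)) (at \<psi> within ?I)"
      by (rule has_vector_derivative_transform[OF \<psi>, rotated]) (auto simp: YX \<Phi>\<theta> boundary_curve_def)
    moreover have "((\<lambda>s. Y (r, s)) has_vector_derivative V (r, \<psi>)) (at \<psi> within ?I)"
      by (rule C1_partials_D2[OF Y]) (use S \<psi> in auto)
    ultimately show ?thesis using vector_derivative_unique_within[OF nontriv[OF \<psi>]] by blast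
  qed
  have nz: "\<theta>' \<psi> \<noteq> 0" if "\<psi> \<in> ?I" for \<psi>
    using V\<theta>[OF that] V_nonzero[of r \<psi>] r that by auto
  then show "\<theta>' \<phi> \<noteq> 0" using \<phi> .
  have orth: "Z (r, \<psi>) \<bullet> ?c' (\<theta> \<psi>) = 0" if "\<psi> \<in> ?I" for \<psi>
    using ZV[OF S, of \<psi>] V\<theta>[OF that] nz[OF that] that by auto
  have S\<phi>: "(r, \<phi>) \<in> polar_rect r" using S \<phi> by auto
  have dZ: "((\<lambda>s. Z (r, s)) has_vector_derivative Z\<^sub>2 (r, \<phi>)) (at \<phi> within ?I)"
    by (rule C1_partials_D2[OF Z]) (use S \<phi> in auto)
  have dc: "((\<lambda>s. ?c' (\<theta> s)) has_vector_derivative \<theta>' \<phi> *\<^sub>R ?c'' (\<theta> \<phi>)) (at \<phi> within ?I)"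
    using vector_diff_chain_within[OF d\<theta>'[OF \<phi>] has_vector_derivative_at_within[OF C(2)]] by (simp add: o_def)
  have "((\<lambda>s. Z (r, s) \<bullet> ?c' (\<theta> s)) has_vector_derivative
      Z (r, \<phi>) \<bullet> (\<theta>' \<phi> *\<^sub>R ?c'' (\<theta> \<phi>)) + Z\<^sub>2 (r, \<phi>) \<bullet> ?c' (\<theta> \<phi>)) (at \<phi> within ?I)"
    by (rule bounded_bilinear.has_vector_derivative[OF bounded_bilinear_inner dZ dc])
  moreover have "((\<lambda>s. Z (r, s) \<bullet> ?c' (\<theta> s)) has_vector_derivative 0) (at \<phi> within ?I)"
    by (rule has_vector_derivative_transform[OF \<phi> _ has_vector_derivative_const[of 0]]) (simp add: orth)
  ultimately have "Z (r, \<phi>) \<bullet> (\<theta>' \<phi> *\<^sub>R ?c'' (\<theta> \<phi>)) + Z\<^sub>2 (r, \<phi>) \<bullet> ?c' (\<theta> \<phi>) = 0"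
    using vector_derivative_unique_within[OF nontriv[OF \<phi>]] by blast
  then have d: "Z\<^sub>2 (r, \<phi>) \<bullet> ?c' (\<theta> \<phi>) = - (\<theta>' \<phi> * (Z (r, \<phi>) \<bullet> ?c'' (\<theta> \<phi>)))" by simp
  have "\<theta>' \<phi> *\<^sub>R ?c' (\<theta> \<phi>) = J (r, \<phi>) *\<^sub>R cross3 (n (r, \<phi>)) (Z (r, \<phi>))"
    using V\<theta>[OF \<phi>] J_squared(2)[OF S\<phi>] by simp
  then have "inverse (\<theta>' \<phi>) *\<^sub>R \<theta>' \<phi> *\<^sub>R ?c' (\<theta> \<phi>) =
      inverse (\<theta>' \<phi>) *\<^sub>R J (r, \<phi>) *\<^sub>R cross3 (n (r, \<phi>)) (Z (r, \<phi>))" by (rule arg_cong)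
  then have k: "?c' (\<theta> \<phi>) = (inverse (\<theta>' \<phi>) * J (r, \<phi>)) *\<^sub>R cross3 (n (r, \<phi>)) (Z (r, \<phi>))"
    using nz[OF \<phi>] by simp
  have "inverse (\<theta>' \<phi>) * J (r, \<phi>) \<noteq> 0"
    using C(5)[of "\<theta> \<phi>"] k by (metis scaleR_zero_left)
  from geodesic_curvature_algebra[OF nn[OF S\<phi>] ZZ[OF S\<phi>] nZ[OF S\<phi>] k this d]
  show "\<bar>J\<^sub>1 (r, \<phi>)\<bar> = \<bar>geodesic_curvature X (\<theta> \<phi>)\<bar> * norm (?c' (\<theta> \<phi>)) * \<bar>\<theta>' \<phi>\<bar>"
    using \<phi> by (simp add: J\<^sub>1_def geodesic_curvature_def nX \<Phi>\<theta>)
qed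

end

text \<open>The pointwise bound \<open>|J(\<rho>, \<phi>)| \<le> \<rho> h(\<phi>) / k\<close>, with \<open>h d\<phi>\<close> the boundary measure
  \<open>\<kappa> ds\<close> in the polar angle and \<open>k = 1 - K r\<^sup>2/2\<close>, is integrated over the polar rectangle. Its
  right-hand side is continuous on the closed rectangle, which allows iterated integration.\<close>

lemma geodesic_disc_area_bound:
  assumes X: "C_k_on 3 X disc" and imm: "immersion_disc X"
    and c: "C2_regular_curve (boundary_curve X)" and r: "r > 0"
    and pc: "geodesic_polar_coordinates X w\<^sub>0 r \<Phi> P"
    and K: "K \<ge> 0" and curv: "\<forall>w\<in>disc. gauss_curvature X w \<le> K"
    and small: "K / 2 * r\<^sup>2 < 1"
  shows "surface_area X * (1 - K / 2 * r\<^sup>2) \<le> r\<^sup>2 / 2 * total_boundary_curvature X"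
proof -
  note img = polar_disc_images[OF pc r]
  note Xs = C_k_on_3_partials[OF X]
  obtain a b Z V n Z\<^sub>1 Z\<^sub>2 n\<^sub>1 n\<^sub>2 l l\<^sub>1 l\<^sub>2
    where \<Phi>: "C1_partials \<Phi> a b (polar_rect r)"
    and frame: "geodesic_frame r (\<lambda>x. X (\<Phi> x)) Z V Z\<^sub>1 Z\<^sub>2 n n\<^sub>1 n\<^sub>2 l l\<^sub>1 l\<^sub>2"
    and n_eq: "\<And>x. n x = unit_normal X (\<Phi> x)"
    and P: "\<And>x. x \<in> polar_rect r \<Longrightarrow> V x \<bullet> V x = P x"
    and det: "\<And>x. x \<in> polar_rect r \<Longrightarrow> V x \<bullet> cross3 (n x) (Z x) =
            (fst (a x) * snd (b x) - snd (a x) * fst (b x)) * norm (cross3 (D_u X (\<Phi> x)) (D_v X (\<Phi> x)))"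
    and gauss: "\<And>x. x \<in> polar_rect r \<Longrightarrow> \<Phi> x \<in> interior disc \<Longrightarrow>
            cross3 (Z x) (V x) \<bullet> cross3 (n\<^sub>1 x) (n\<^sub>2 x) =
              gauss_curvature X (\<Phi> x) * (V x \<bullet> cross3 (n x) (Z x))\<^sup>2"
    by (rule geodesic_polar_frame[OF X imm r pc]) (rule that)
  interpret geodesic_frame r "\<lambda>x. X (\<Phi> x)" Z V Z\<^sub>1 Z\<^sub>2 n n\<^sub>1 n\<^sub>2 l l\<^sub>1 l\<^sub>2 by (rule frame)
  define R where "R = {0<..r} \<times> {0..<2 * pi}"
  have R: "R \<subseteq> polar_rect r" by (auto simp: R_def polar_rect_def)
  define W where "W = (\<lambda>w. norm (cross3 (D_u X w) (D_v X w)))"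
  have cW: "continuous_on disc W"
    unfolding W_def using C1_partialsD(2,3)[OF Xs(1)] by (intro continuous_intros continuous_on_cross)
  define g where "g = (\<lambda>t. boundary_curvature X t * norm (boundary_velocity X t))"
  have cN: "continuous_on disc (unit_normal X)"
    using unit_normal_C1[OF X imm] C1_partialsD(4) by metis
  have g: "continuous_on UNIV g" "\<And>t. g (t + 2 * pi) = g t" "\<And>t. g t \<ge> 0"
    "\<And>t. \<bar>geodesic_curvature X t\<bar> * norm (boundary_velocity X t) \<le> g t"
    unfolding g_def by (rule boundary_curvature_density[OF cN c])+
  have rS: "(r, \<phi>) \<in> polar_rect r" if "\<phi> \<in> {0..2 * pi}" for \<phi>
    using that r by (auto simp: polar_rect_def)
  obtain \<theta> \<theta>' where c\<theta>': "continuous_on {0..2 * pi} \<theta>'"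
    and d\<theta>: "\<And>t. t \<in> {0..2 * pi} \<Longrightarrow> (\<theta> has_real_derivative \<theta>' t) (at t within {0..2 * pi})"
    and \<Phi>\<theta>: "\<And>t. t \<in> {0..2 * pi} \<Longrightarrow> \<Phi> (r, t) = (cos (\<theta> t), sin (\<theta> t))"
  proof (rule angle_function[of 0 "2 * pi" "\<lambda>t. \<Phi> (r, t)" "\<lambda>t. b (r, t)"])
    show "((\<lambda>t. \<Phi> (r, t)) has_vector_derivative b (r, t)) (at t within {0..2 * pi})" if "t \<in> {0..2 * pi}" for t
      by (rule C1_partials_D2[OF \<Phi>]) (use rS that in auto)
    show "continuous_on {0..2 * pi} (\<lambda>t. b (r, t))"
      by (rule continuous_on_compose2[OF C1_partialsD(3)[OF \<Phi>]]) (use rS in \<open>auto intro!: continuous_intros\<close>)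
    show "(fst (\<Phi> (r, t)))\<^sup>2 + (snd (\<Phi> (r, t)))\<^sup>2 = 1" if "t \<in> {0..2 * pi}" for t
      using img(2)[OF that] by (auto simp: circle_def)
  qed auto
  have c\<theta>: "continuous_on {0..2 * pi} \<theta>"
    by (auto simp: continuous_on_eq_continuous_within intro!: DERIV_continuous d\<theta>)
  define h where "h = (\<lambda>t. g (\<theta> t) * \<bar>\<theta>' t\<bar>)"
  have ch: "continuous_on {0..2 * pi} h"
    unfolding h_def by (intro continuous_intros continuous_on_compose2[OF g(1) c\<theta>] c\<theta>') auto
  have bd: "\<theta>' \<phi> \<noteq> 0"
    "\<bar>J\<^sub>1 (r, \<phi>)\<bar> = \<bar>geodesic_curvature X (\<theta> \<phi>)\<bar> * norm (boundary_velocity X (\<theta> \<phi>)) * \<bar>\<theta>' \<phi>\<bar>"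
    if "\<phi> \<in> {0..<2 * pi}" for \<phi>
    using J1_boundary[OF c refl n_eq d\<theta> \<Phi>\<theta> that] by auto
  have int_h: "integral {0..2 * pi} h \<le> total_boundary_curvature X"
    unfolding h_def total_boundary_curvature_def g_def[symmetric]
  proof (rule integral_substitution_injective_circle[OF g(1,3,2) d\<theta> c\<theta>' bd(1)])
    show "inj_on (\<lambda>t. (cos (\<theta> t), sin (\<theta> t))) {0..<2 * pi}"
      using img(3) \<Phi>\<theta> by (auto simp: inj_on_def)
  qed auto
  define k where "k = 1 - K / 2 * r\<^sup>2"
  have k: "k > 0" using small by (simp add: k_def)
  have J_le: "\<bar>J x\<bar> \<le> fst x * h (snd x) / k" if x: "x \<in> R" for x
  proof -
    obtain \<rho> \<phi> where x: "x = (\<rho>, \<phi>)" "\<rho> \<in> {0<..r}" "\<phi> \<in> {0..<2 * pi}" using x by (auto simp: R_def)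
    have "\<bar>J (\<rho>, \<phi>)\<bar> * k \<le> \<rho> * \<bar>J\<^sub>1 (r, \<phi>)\<bar>"
      unfolding k_def
    proof (rule J_bound[OF x(3,2) K small])
      fix s assume s: "s \<in> {0<..<r}"
      then have sS: "(s, \<phi>) \<in> polar_rect r" using x by (auto simp: polar_rect_def)
      have i: "\<Phi> (s, \<phi>) \<in> interior disc" by (rule img(4)[OF s x(3)])
      then have "gauss_curvature X (\<Phi> (s, \<phi>)) \<le> K" using curv interior_subset by blast
      then show "cross3 (Z (s, \<phi>)) (V (s, \<phi>)) \<bullet> cross3 (n\<^sub>1 (s, \<phi>)) (n\<^sub>2 (s, \<phi>)) \<le> K * (J (s, \<phi>))\<^sup>2"
        unfolding gauss[OF sS i] J_def by (intro mult_right_mono) auto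
    next
      have "((\<lambda>s. P (s, \<phi>)) \<longlongrightarrow> 0) (at_right 0)" using geodesic_polar_coordinatesD(8)[OF pc] x(3) by auto
      from tendsto_real_sqrt[OF this] have "((\<lambda>s. sqrt (P (s, \<phi>))) \<longlongrightarrow> 0) (at_right 0)" by simp
      moreover have "\<forall>\<^sub>F s in at_right 0. sqrt (P (s, \<phi>)) = \<bar>J (s, \<phi>)\<bar>"
      proof (rule eventually_mono[OF eventually_at_right_real[OF r]])
        fix s assume "s \<in> {0<..<r}"
        then have sS: "(s, \<phi>) \<in> polar_rect r" using x by (auto simp: polar_rect_def)
        show "sqrt (P (s, \<phi>)) = \<bar>J (s, \<phi>)\<bar>"
          using J_squared(1)[OF sS] P[OF sS] by (metis real_sqrt_abs)
      qed
      ultimately have "((\<lambda>s. \<bar>J (s, \<phi>)\<bar>) \<longlongrightarrow> 0) (at_right 0)"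
        by (rule Lim_transform_eventually)
      then show "((\<lambda>s. J (s, \<phi>)) \<longlongrightarrow> 0) (at_right 0)" by (rule tendsto_rabs_zero_cancel)
    qed
    also have "\<dots> \<le> \<rho> * h \<phi>"
    proof (intro mult_left_mono)
      show "\<bar>J\<^sub>1 (r, \<phi>)\<bar> \<le> h \<phi>"
        unfolding bd(2)[OF x(3)] h_def by (intro mult_right_mono g(4)) auto
    qed (use x in auto)
    finally show ?thesis using k by (simp add: x field_simps)
  qed
  have Rsub: "R \<subseteq> cbox (0, 0) (r, 2 * pi)" by (auto simp: R_def cbox_Pair_eq)
  have Rbox: "bounded R" by (rule bounded_subset[OF bounded_cbox Rsub])
  have Rleb: "R \<in> sets lebesgue"
    unfolding R_def by (intro sets_completionI_sets) (auto intro!: borel_Times)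
  define m where "m = (\<lambda>x. fst x * h (snd x) / k)"
  have cm: "continuous_on (cbox (0, 0) (r, 2 * pi)) m"
    unfolding m_def using k
    by (intro continuous_intros continuous_on_compose2[OF ch]) (auto simp: cbox_Pair_eq)
  then obtain B where B: "\<And>x. x \<in> cbox (0, 0) (r, 2 * pi) \<Longrightarrow> \<bar>m x\<bar> \<le> B"
    using compact_imp_bounded[OF compact_continuous_image[OF cm compact_cbox]]
    by (auto simp: bounded_iff)
  have mR: "m integrable_on R"
    by (rule bounded_continuous_integrable[OF continuous_on_subset[OF cm Rsub] Rleb Rbox]) (use B Rsub in auto)
  have JR: "(\<lambda>x. \<bar>J x\<bar>) integrable_on R"
  proof (rule bounded_continuous_integrable[OF _ Rleb Rbox])
    show "continuous_on R (\<lambda>x. \<bar>J x\<bar>)"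
      by (intro continuous_intros continuous_on_subset[OF continuous_J(1) R])
    show "\<bar>\<bar>J x\<bar>\<bar> \<le> B" if "x \<in> R" for x
    proof -
      have "\<bar>J x\<bar> \<le> m x" using J_le[OF that] by (simp add: m_def)
      moreover have "\<bar>m x\<bar> \<le> B" using B Rsub that by blast
      ultimately show ?thesis by linarith
    qed
  qed
  have J_det: "\<bar>fst (a x) * snd (b x) - snd (a x) * fst (b x)\<bar> * W (\<Phi> x) = \<bar>J x\<bar>" if "x \<in> R" for x
    using det[of x] R that by (auto simp: J_def W_def abs_mult)
  have "surface_area X = integral (disc - {w\<^sub>0}) W"
    unfolding surface_area_def W_def
    by (rule integral_spike_set) (auto intro: negligible_subset[OF negligible_sing[of w\<^sub>0]])
  also have "\<dots> = integral (\<Phi> ` R) W" using img(1) by (simp add: R_def)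
  also have "\<dots> \<le> integral R (\<lambda>x. \<bar>fst (a x) * snd (b x) - snd (a x) * fst (b x)\<bar> * W (\<Phi> x))"
  proof (rule integral_image_le_plane)
    show "0 \<le> W (\<Phi> x)" for x by (simp add: W_def)
    show "(\<Phi> has_derivative (\<lambda>h. fst h *\<^sub>R a x + snd h *\<^sub>R b x)) (at x within R)" if "x \<in> R" for x
      using C1_partialsD(1)[OF C1_partials_subset[OF \<Phi> R] that] .
    have im: "\<Phi> ` R = disc - {w\<^sub>0}" using img(1) by (simp add: R_def)
    then show bim: "bounded (\<Phi> ` R)" by (auto intro: bounded_subset[of disc] simp: disc_eq_cball)
    have "compact disc" by (simp add: disc_eq_cball)
    then obtain B' where B': "\<And>w. w \<in> disc \<Longrightarrow> \<bar>W w\<bar> \<le> B'"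
      using compact_imp_bounded[OF compact_continuous_image[OF cW \<open>compact disc\<close>]]
      by (auto simp: bounded_iff)
    show "W integrable_on \<Phi> ` R"
      unfolding im
    proof (rule bounded_continuous_integrable)
      show "disc - {w\<^sub>0} \<in> sets lebesgue"
        unfolding disc_eq_cball by (intro sets_completionI_sets) auto
    qed (use cW B' bim im in \<open>auto intro: continuous_on_subset\<close>)
    show "(\<lambda>x. \<bar>fst (a x) * snd (b x) - snd (a x) * fst (b x)\<bar> * W (\<Phi> x)) integrable_on R"
      by (rule integrable_eq[OF JR]) (simp add: J_det)
  qed (rule Rbox)
  also have "\<dots> = integral R (\<lambda>x. \<bar>J x\<bar>)" by (rule integral_cong) (rule J_det)
  also have "\<dots> \<le> integral R m"
    by (rule integral_le[OF JR mR]) (simp add: J_le m_def)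
  also have "\<dots> \<le> integral (cbox (0, 0) (r, 2 * pi)) m"
  proof (rule integral_subset_le[OF Rsub mR integrable_continuous[OF cm]], intro ballI)
    fix x assume "x \<in> cbox (0, 0) (r, 2 * pi)"
    then show "0 \<le> m x"
      using k g(3) by (auto simp: m_def h_def cbox_Pair_eq intro!: divide_nonneg_pos mult_nonneg_nonneg)
  qed
  also have "\<dots> = integral {0..r} (\<lambda>\<rho>. \<rho> * (integral {0..2 * pi} h / k))"
    by (subst integral_prod_continuous[OF cm]) (simp add: m_def integral_divide)
  also have "\<dots> = r\<^sup>2 / 2 * (integral {0..2 * pi} h / k)"
    using ident_has_integral[of 0 r] r by (simp add: integral_unique)
  finally have "surface_area X * k \<le> r\<^sup>2 / 2 * integral {0..2 * pi} h"
    using k by (simp add: field_simps)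
  also have "\<dots> \<le> r\<^sup>2 / 2 * total_boundary_curvature X"
    using int_h by (intro mult_left_mono) auto
  finally show ?thesis by (simp add: k_def)
qed

theorem mainTheorem3:
  fixes X :: "real \<times> real \<Rightarrow> real ^ 3" and X\<^sub>0 :: "real ^ 3" and r K\<^sub>0 :: real
  assumes "C_k_on 3 X disc"
    and "immersion_disc X"
    and "C2_regular_curve (boundary_curve X)"
    and "r > 0"
    and "geodesic_disc X X\<^sub>0 r"
    and "K\<^sub>0 \<ge> 0"
    and "\<forall>w\<in>disc. gauss_curvature X w \<le> K\<^sub>0"
  shows "surface_area X
           \<le> K\<^sub>0 / 2 * surface_area X * r\<^sup>2 + r\<^sup>2 / 2 * total_boundary_curvature X
         \<and> (K\<^sub>0 = 0 \<longrightarrow> surface_area X \<le> r\<^sup>2 / 2 * total_boundary_curvature X)"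
proof -
  have "surface_area X * (1 - K\<^sub>0 / 2 * r\<^sup>2) \<le> r\<^sup>2 / 2 * total_boundary_curvature X"
  proof (cases "K\<^sub>0 / 2 * r\<^sup>2 < 1")
    case True
    obtain w\<^sub>0 \<Phi> P where "geodesic_polar_coordinates X w\<^sub>0 r \<Phi> P"
      using assms(5) by (auto simp: geodesic_disc_def)
    from geodesic_disc_area_bound[OF assms(1-4) this assms(6,7) True] show ?thesis .
  next
    case False
    have "0 \<le> total_boundary_curvature X"
      unfolding total_boundary_curvature_def boundary_curvature_def
      by (rule integral_nonneg_always) auto
    then have "0 \<le> r\<^sup>2 / 2 * total_boundary_curvature X" by simp
    moreover have "surface_area X * (1 - K\<^sub>0 / 2 * r\<^sup>2) \<le> 0"
      using False surface_area_nonneg[of X] by (intro mult_nonneg_nonpos) auto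
    ultimately show ?thesis by linarith
  qed
  then show ?thesis by (auto simp: algebra_simps)
qed

end
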